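(* Let $\mathbf{X}$ be an edge-reinforced random walk on $\mathbb{Z}_+$ with factor type reinforcement $f(\ell,x)=\delta_\ell\cdot f(0,x)$, and suppose that the sequence $\boldsymbol{\delta}=(\delta_\ell)_{\ell\in\mathbb{Z}_+}$ is of down-only type. Let $f(0,x)=(x+1)^{\alpha}$ and $\delta_{2k}=(k+1)^{\rho}$ for all $x,k\in\mathbb{Z}_+$, with $\alpha\in(1/2,1]$ and $\rho\in[0,\infty)$. \begin{itemize} \item[1)] If $\rho\in[0,1-\alpha]$, then $\mathbf{X}$ is recurrent a.s. \item[2)] If $\rho\in(1-\alpha,1/2]$ and $\rho>(1.5-\alpha)/(2.5-\alpha)$, then $\mathbf{X}$ is transient a.s. \item[3)] If $\rho\in(1/2,1]$, then $\mathbf{X}$ is transient a.s. \item[4)] If $\rho\in(1,\infty)$, then $\mathbf{X}$ localizes on a single edge a.s. \end{itemize}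
   Context: Notation: $\mathbb{Z}_+=\{0,1,2,\ldots\}$ and $\mathbb{N}=\{1,2,\ldots\}$. Edge-reinforced random walk (ERRW) on $\mathbb{Z}_+$: for each $x\in\mathbb{Z}_+$ let $(f(\ell,x):\ell\in\mathbb{Z}_+)$ be a non-decreasing sequence of positive numbers (the reinforcement scheme at $x$). The process $\mathbf{X}=(X_n)_{n\ge 0}$ takes values in $\mathbb{Z}_+$, starts at $X_0=0$, and moves to a nearest neighbour at each step. Let $\phi_n(x)=\sum_{i=1}^n \mathbf{1}\{\{X_{i-1},X_i\}=\{x,x+1\}\}$ be the number of traversals (in either direction) of the edge $\{x,x+1\}$ by time $n$, let $w_n(x)=f(\phi_n(x),x)$ for $x\in\mathbb{Z}_+$, and set $w_n(-1)=0$. The transition probabilities are $$\mathbb{P}(X_{n+1}=X_n+1\mid X_0,\ldots,X_n)=1-\mathbb{P}(X_{n+1}=X_n-1\mid X_0,\ldots,X_n)=\frac{w_n(X_n)}{w_n(X_n-1)+w_n(X_n)}.$$ Factor type reinforcement (FTR): $f(\ell,x)=\delta_\ell\cdot f(0,x)$ for all $\ell,x\in\mathbb{Z}_+$, where $\boldsymbol{\delta}=(\delta_\ell:\ell\in\mathbb{Z}_+)$ is a positive non-decreasing sequence with $\delta_0=1$. Down-only type (DT): $\boldsymbol{\delta}$ is non-decreasing, $\delta_0=1$, and $\delta_{2k}=\delta_{2k+1}$ for all $k\in\mathbb{Z}_+$. A path of $\mathbf{X}$ is recurrent if every point of $\mathbb{Z}_+$ is visited infinitely often; transient if every point is visited only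 finitely many times; it localizes if the set of points visited infinitely often is finite (and nonempty). It localizes on a single edge if the set of points visited infinitely often is $\{x,x+1\}$ for some $x\in\mathbb{Z}_+$, i.e. from some time on the walk only traverses the one edge $\{x,x+1\}$. *)

theory Defs
  imports "HOL-Probability.Probability"
begin

definition reinforcement_scheme :: "(nat \<Rightarrow> nat \<Rightarrow> real) \<Rightarrow> bool" where
  "reinforcement_scheme f \<longleftrightarrow> (\<forall>x. (\<forall>l. 0 < f l x) \<and> mono (\<lambda>l. f l x))"

definition factor_type :: "(nat \<Rightarrow> real) \<Rightarrow> (nat \<Rightarrow> nat \<Rightarrow> real) \<Rightarrow> bool" where
  "factor_type \<delta> f \<longleftrightarrow>
     (\<forall>l. 0 < \<delta> l) \<and> mono \<delta> \<and> \<delta> 0 = 1 \<and> (\<forall>l x. f l x = \<delta> l * f 0 x)"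

definition down_only_type :: "(nat \<Rightarrow> real) \<Rightarrow> bool" where
  "down_only_type \<delta> \<longleftrightarrow> mono \<delta> \<and> \<delta> 0 = 1 \<and> (\<forall>k. \<delta> (2 * k) = \<delta> (2 * k + 1))"

definition traversals :: "(nat \<Rightarrow> nat) \<Rightarrow> nat \<Rightarrow> nat \<Rightarrow> nat" where
  "traversals p n x = (\<Sum>i=1..n. of_bool ({p (i - 1), p i} = {x, x + 1}))"

text \<open>The edge to the right of \<open>x\<close> is indexed by the integer \<open>x\<close>, so that the
  edge with index \<open>-1\<close> exists and has weight \<open>0\<close>.\<close>

definition edge_weight ::
  "(nat \<Rightarrow> nat \<Rightarrow> real) \<Rightarrow> (nat \<Rightarrow> nat) \<Rightarrow> nat \<Rightarrow> int \<Rightarrow> real" where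
  "edge_weight f p n x = (if x < 0 then 0 else f (traversals p n (nat x)) (nat x))"

definition history :: "'a measure \<Rightarrow> (nat \<Rightarrow> 'a \<Rightarrow> nat) \<Rightarrow> nat \<Rightarrow> 'a measure" where
  "history M X n = sigma (space M) {X i -` A \<inter> space M | i A. i \<le> n}"

lemma subalgebra_history:
  assumes "\<And>n. X n \<in> measurable M (count_space UNIV)"
  shows "subalgebra M (history M X n)"
proof -
  have "{X i -` A \<inter> space M | i A. i \<le> n} \<subseteq> sets M"
    using assms by (auto intro: measurable_sets)
  then show ?thesis
    unfolding subalgebra_def history_def
    by (subst sets_measure_of)
      (auto simp: space_measure_of_conv intro: sets.sigma_sets_subset[THEN subsetD])
qed

text \<open>The conditional probability of an event given \<open>X\<^sub>0, \<dots>, X\<^sub>n\<close> is the conditional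
  expectation of its indicator with respect to \<open>history M X n\<close>.\<close>

locale edge_reinforced_random_walk = prob_space M
  for M :: "'a measure" +
  fixes f :: "nat \<Rightarrow> nat \<Rightarrow> real" and X :: "nat \<Rightarrow> 'a \<Rightarrow> nat"
  assumes scheme: "reinforcement_scheme f"
    and measurable_walk: "\<And>n. X n \<in> measurable M (count_space UNIV)"
    and start: "AE \<omega> in M. X 0 \<omega> = 0"
    and nearest_neighbour: "\<And>n. AE \<omega> in M. \<bar>int (X (Suc n) \<omega>) - int (X n \<omega>)\<bar> = 1"
    and step_up: "\<And>n. AE \<omega> in M.
      real_cond_exp M (history M X n)
        (indicator {\<omega> \<in> space M. int (X (Suc n) \<omega>) = int (X n \<omega>) + 1}) \<omega> =
      (let w = edge_weight f (\<lambda>i. X i \<omega>) n; x = int (X n \<omega>) in w x / (w (x - 1) + w x))"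
    and step_down: "\<And>n. AE \<omega> in M.
      1 - real_cond_exp M (history M X n)
        (indicator {\<omega> \<in> space M. int (X (Suc n) \<omega>) = int (X n \<omega>) - 1}) \<omega> =
      (let w = edge_weight f (\<lambda>i. X i \<omega>) n; x = int (X n \<omega>) in w x / (w (x - 1) + w x))"

definition visited_inf_often :: "(nat \<Rightarrow> nat) \<Rightarrow> nat set" where
  "visited_inf_often p = {x. infinite {n. p n = x}}"

definition recurrent_path :: "(nat \<Rightarrow> nat) \<Rightarrow> bool" where
  "recurrent_path p \<longleftrightarrow> (\<forall>x. infinite {n. p n = x})"

definition transient_path :: "(nat \<Rightarrow> nat) \<Rightarrow> bool" where
  "transient_path p \<longleftrightarrow> (\<forall>x. finite {n. p n = x})"

definition localizes_on_single_edge :: "(nat \<Rightarrow> nat) \<Rightarrow> bool" where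
  "localizes_on_single_edge p \<longleftrightarrow> (\<exists>x. visited_inf_often p = {x, x + 1})"

end

theory Submission
  imports Defs
begin

text \<open>
  The even-odd pairing of \<open>\<delta>\<close> turns the walk into a family of urns, one at each vertex. When the
  walk is at \<open>x\<close>, the edge to its right has been crossed an even number of times and the edge to
  its left an odd number of times. If \<open>x\<close> has so far been left upwards \<open>k\<close> times and downwards \<open>j\<close>
  times, the two weights are therefore \<open>c (x + 1) * d k\<close> and \<open>c x * d j\<close> with \<open>c y = y powr \<alpha>\<close> and
  \<open>d i = (i + 1) powr \<rho>\<close>. They depend on the past only through what happened at \<open>x\<close>, and they
  suggest two kinds of martingales. Put \<open>F k = (\<Sum>i<k. 1 / d i)\<close>.

  The first one is the gap \<open>D\<^sub>y = F k / c (y + 1) - F j / c y\<close> of the urn at \<open>y > 0\<close>. A draw changes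
  only one gap, so gaps of different urns are orthogonal, and the variance of a gap is the
  expectation of the sum of its squared jumps. At a time when the walk is at \<open>0\<close>, every
  edge has been crossed as often upwards as downwards; then the gaps telescope to
  \<open>- F m / c 1\<close>, where \<open>m\<close> is the number of departures from \<open>0\<close>.

  The second one is \<open>(\<Prod>i<k. 1 + z / a\<^sub>i) * (\<Prod>i<j. 1 - z / b\<^sub>i)\<close> for any complex \<open>z\<close>, where \<open>a\<^sub>i\<close> and \<open>b\<^sub>i\<close>
  are the successive weights of the urn. Embedding the urn into independent exponential clocks would
  make it a conditional Laplace transform of the difference of two clock times.

  If \<open>\<rho> \<le> 1\<close>, then \<open>\<Sum>i. 1 / d i\<close> diverges, and small real \<open>z\<close> shows that a vertex that is visited
  infinitely often is left infinitely often in both directions (\<open>inf_ups_imp_inf_downs\<close>,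
  \<open>inf_downs_imp_inf_ups\<close>). Hence almost every path is recurrent or transient.

  Transience for \<open>1 - \<alpha> < \<rho> \<le> 1\<close> is Chebyshev's inequality: stop at the \<open>m\<close>-th return to \<open>0\<close>. The mean
  of \<open>F k\<close> at \<open>y\<close> is at most \<open>c (y + 1) * F m / c 1\<close>, and since the squared jumps sum to at most
  \<open>C * F k powr \<gamma>\<close> with \<open>\<gamma> < 2 - 1 / \<alpha>\<close>, the total variance of the gaps is \<open>O (F m powr \<gamma>)\<close>. The
  \<open>m\<close>-th return makes the sum of the gaps equal to \<open>- F m / c 1\<close>, so its probability is
  \<open>O (F m powr (\<gamma> - 2))\<close>, which tends to \<open>0\<close> (\<open>AE_transient\<close>).

  Recurrence for \<open>\<rho> \<le> 1 - \<alpha>\<close> compares with the resistance of the path below the walk: with the same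
  stopping, the mean of \<open>\<Sum>y<X\<^sub>n. 1 / w\<^sub>n y\<close> never exceeds \<open>F m / c 1\<close>. On the other hand the bound
  on the mean of \<open>F k\<close> keeps most crossing numbers at \<open>y\<close> below a multiple of \<open>y\<close>, and then each
  term is at least a multiple of \<open>1 / (y + 1)\<close>. As the harmonic series diverges, the walk cannot stay
  high with positive probability (\<open>AE_recurrent\<close>).

  Localization for \<open>\<rho> > 1\<close> has two parts. From each first visit to a vertex the walk has a uniformly
  positive chance to cross the next edge back and forth forever, so the path is bounded. And
  letting \<open>z\<close> tend to infinity along the imaginary axis shows that an urn cannot draw both colours
  infinitely often (\<open>AE_urn_fixates\<close>). A bounded path all of whose urns fixate ends on one edge.
\<close>

section \<open>Paths and departures\<close>

text \<open>
  A configuration consists of the position of the walk and of the numbers of departures from each vertex,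
  upwards and downwards.
\<close>

type_synonym urn_config = "nat \<times> (nat \<Rightarrow> nat) \<times> (nat \<Rightarrow> nat)"

fun up_state :: "urn_config \<Rightarrow> urn_config" where
  "up_state (x, k, j) = (Suc x, k(x := Suc (k x)), j)"

fun down_state :: "urn_config \<Rightarrow> urn_config" where
  "down_state (x, k, j) = (x - 1, k, j(x := Suc (j x)))"

primrec urn_state :: "(nat \<Rightarrow> nat) \<Rightarrow> nat \<Rightarrow> urn_config" where
  "urn_state p 0 = (p 0, (\<lambda>_. 0), (\<lambda>_. 0))"
| "urn_state p (Suc n) =
    (if p (Suc n) = Suc (p n) then up_state (urn_state p n) else down_state (urn_state p n))"

definition ups :: "(nat \<Rightarrow> nat) \<Rightarrow> nat \<Rightarrow> nat \<Rightarrow> nat" where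
  "ups p n = fst (snd (urn_state p n))"

definition downs :: "(nat \<Rightarrow> nat) \<Rightarrow> nat \<Rightarrow> nat \<Rightarrow> nat" where
  "downs p n = snd (snd (urn_state p n))"

definition walk_path :: "(nat \<Rightarrow> nat) \<Rightarrow> bool" where
  "walk_path p \<longleftrightarrow> p 0 = 0 \<and> (\<forall>n. p (Suc n) = Suc (p n) \<or> p n = Suc (p (Suc n)))"

lemma urn_state_eq: "walk_path p \<Longrightarrow> urn_state p n = (p n, ups p n, downs p n)"
proof (induction n)
  case (Suc n)
  have "p (Suc n) = Suc (p n) \<or> p (Suc n) = p n - 1"
    using Suc.prems unfolding walk_path_def by (metis diff_Suc_1)
  then show ?case using Suc by (cases "urn_state p n") (auto simp: ups_def downs_def)
qed (simp add: ups_def downs_def walk_path_def)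

lemma ups_0 [simp]: "ups p 0 y = 0" and downs_0 [simp]: "downs p 0 y = 0"
  by (simp_all add: ups_def downs_def)

lemma ups_Suc:
  "walk_path p \<Longrightarrow> ups p (Suc n) y = ups p n y + of_bool (p n = y \<and> p (Suc n) = Suc y)"
  using urn_state_eq[of p n] by (auto simp: ups_def[of p "Suc n"])

lemma downs_Suc:
  "walk_path p \<Longrightarrow> downs p (Suc n) y = downs p n y + of_bool (p n = y \<and> y = Suc (p (Suc n)))"
  using urn_state_eq[of p n]
  by (auto simp: downs_def[of p "Suc n"] walk_path_def)

lemma walk_path_le: "walk_path p \<Longrightarrow> p n \<le> n"
proof (induction n)
  case (Suc n)
  then have "p n \<le> n" by simp
  moreover have "p (Suc n) = Suc (p n) \<or> p n = Suc (p (Suc n))"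
    using Suc.prems by (simp add: walk_path_def)
  ultimately show ?case by linarith
qed (simp add: walk_path_def)

text \<open>
  On a path from \<open>0\<close>, the crossings of the edge above \<open>y\<close> alternate between up and
  down and start with an up-crossing. This is the conservation law that couples neighbouring urns; moreover,
  no vertex is left upwards before the vertex below it.
\<close>

definition consistent :: "urn_config \<Rightarrow> bool" where
  "consistent = (\<lambda>(x, k, j). (\<forall>y. k y = j (Suc y) + of_bool (y < x)) \<and>
     (\<forall>y. k y = 0 \<longrightarrow> k (Suc y) = 0))"

lemma ups_eq_downs:
  assumes "walk_path p"
  shows "ups p n y = downs p n (Suc y) + of_bool (y < p n)"
proof (induction n)
  case 0
  then show ?case using assms by (simp add: walk_path_def)
next
  case (Suc n)
  have "p (Suc n) = Suc (p n) \<or> p n = Suc (p (Suc n))"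
    using assms by (simp add: walk_path_def)
  then show ?case
    using Suc by (auto simp: ups_Suc[OF assms] downs_Suc[OF assms] of_bool_def)
qed

lemma consistent_urn_state:
  assumes "walk_path p"
  shows "consistent (urn_state p n)"
proof -
  have "ups p n y = 0 \<longrightarrow> ups p n (Suc y) = 0" for y
  proof (induction n)
    case (Suc n)
    have "ups p n y \<ge> 1" if "p n = Suc y"
      using ups_eq_downs[OF assms, of n y] that by simp
    then show ?case using Suc by (auto simp: ups_Suc[OF assms])
  qed simp
  then show ?thesis
    using ups_eq_downs[OF assms] by (auto simp: consistent_def urn_state_eq[OF assms])
qed

lemma ups_eq_0: "walk_path p \<Longrightarrow> n \<le> y \<Longrightarrow> ups p n y = 0"
proof (induction n)
  case (Suc n)
  then show ?case using walk_path_le[of p n] by (simp add: ups_Suc)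
qed simp

lemma ups_mono: assumes "walk_path p" "m \<le> n" shows "ups p m y \<le> ups p n y"
  using assms(2) by (induction rule: dec_induct) (auto simp: ups_Suc[OF assms(1)])

lemma downs_mono: assumes "walk_path p" "m \<le> n" shows "downs p m y \<le> downs p n y"
  using assms(2) by (induction rule: dec_induct) (auto simp: downs_Suc[OF assms(1)])

text \<open>
  The configuration at the first time at which \<open>B\<close> holds, or at time \<open>n\<close> if this
  comes first. Building the stopping time into the configuration lets one-step arguments replace optional
  stopping.
\<close>

primrec frozen :: "(urn_config \<Rightarrow> bool) \<Rightarrow> (nat \<Rightarrow> nat) \<Rightarrow> nat \<Rightarrow> urn_config" where
  "frozen B p 0 = urn_state p 0"
| "frozen B p (Suc n) = (if B (frozen B p n) then frozen B p n else urn_state p (Suc n))"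

lemma frozen_unstopped: "\<not> B (frozen B p n) \<Longrightarrow> frozen B p n = urn_state p n"
  by (cases n) (auto split: if_splits)

lemma frozen_reached: "\<exists>i\<le>n. frozen B p n = urn_state p i"
  by (induction n) (auto intro: le_SucI)

lemma frozen_never: "(\<And>i. i \<le> n \<Longrightarrow> \<not> B (urn_state p i)) \<Longrightarrow> frozen B p n = urn_state p n"
  by (metis frozen_reached frozen_unstopped)

lemma frozen_False [simp]: "frozen (\<lambda>_. False) p n = urn_state p n"
  by (rule frozen_never) simp

lemma frozen_stopped:
  assumes "B (urn_state p i)" "i \<le> n"
  shows "B (frozen B p n)"
  using assms(2)
proof (induction rule: dec_induct)
  case base
  then show ?case using frozen_unstopped assms(1) by metis
qed auto

lemma consistent_frozen: "walk_path p \<Longrightarrow> consistent (frozen B p n)"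
  using frozen_reached[of n B p] consistent_urn_state by auto

lemma downs_at_0: "walk_path p \<Longrightarrow> downs p n 0 = 0"
  by (induction n) (auto simp: downs_Suc)

lemma ups_plus_downs:
  assumes "walk_path p"
  shows "ups p n y + downs p n y = card ({i. p i = y} \<inter> {..<n})"
proof (induction n)
  case (Suc n)
  have step: "p (Suc n) = Suc (p n) \<or> p n = Suc (p (Suc n))"
    using assms by (simp add: walk_path_def)
  have "{i. p i = y} \<inter> {..<Suc n} = (if p n = y then insert n ({i. p i = y} \<inter> {..<n}) else {i. p i = y} \<inter> {..<n})"
    by (auto simp: less_Suc_eq)
  then have "card ({i. p i = y} \<inter> {..<Suc n}) = card ({i. p i = y} \<inter> {..<n}) + of_bool (p n = y)"
    by simp
  moreover have "of_bool (p n = y \<and> p (Suc n) = Suc y) + of_bool (p n = y \<and> y = Suc (p (Suc n))) =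
      (of_bool (p n = y) :: nat)"
    using step by (auto simp: of_bool_def)
  ultimately show ?case
    using Suc by (simp add: ups_Suc[OF assms] downs_Suc[OF assms])
qed simp

text \<open>
  Infinitely many visits become unbounded counts, which are monotone in time and easier to pass to limits
  with.
\<close>

lemma infinite_iff_card_initial:
  fixes S :: "nat set"
  shows "infinite S \<longleftrightarrow> (\<forall>K. \<exists>n. K \<le> card (S \<inter> {..<n}))"
proof
  assume inf: "infinite S"
  show "\<forall>K. \<exists>n. K \<le> card (S \<inter> {..<n})"
  proof
    fix K
    obtain T where T: "finite T" "card T = K" "T \<subseteq> S"
      using infinite_arbitrarily_large[OF inf] by blast
    have "T \<subseteq> S \<inter> {..<Suc (Max T)}" using T by (auto simp: less_Suc_eq_le)
    then have "K \<le> card (S \<inter> {..<Suc (Max T)})" using T(2) by (metis card_mono finite_Int finite_lessThan)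
    then show "\<exists>n. K \<le> card (S \<inter> {..<n})" by blast
  qed
next
  assume all: "\<forall>K. \<exists>n. K \<le> card (S \<inter> {..<n})"
  show "infinite S"
  proof
    assume "finite S"
    then have "card (S \<inter> {..<n}) \<le> card S" for n by (intro card_mono) auto
    with all show False by (metis not_less_eq_eq)
  qed
qed

definition inf_ups :: "(nat \<Rightarrow> nat) \<Rightarrow> nat \<Rightarrow> bool" where
  "inf_ups p y \<longleftrightarrow> (\<forall>K. \<exists>n. K \<le> ups p n y)"

definition inf_downs :: "(nat \<Rightarrow> nat) \<Rightarrow> nat \<Rightarrow> bool" where
  "inf_downs p y \<longleftrightarrow> (\<forall>K. \<exists>n. K \<le> downs p n y)"

lemma not_inf_downs_0:
  assumes "walk_path p"
  shows "\<not> inf_downs p 0"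
proof
  assume "inf_downs p 0"
  then obtain n where "1 \<le> downs p n 0" unfolding inf_downs_def by blast
  with downs_at_0[OF assms] show False by simp
qed

lemma inf_ups_at_top:
  assumes "walk_path p"
  shows "inf_ups p y \<longleftrightarrow> filterlim (\<lambda>n. ups p n y) at_top sequentially"
  unfolding inf_ups_def filterlim_at_top eventually_sequentially
  using ups_mono[OF assms] by (meson order.refl order.trans)

lemma inf_downs_at_top:
  assumes "walk_path p"
  shows "inf_downs p y \<longleftrightarrow> filterlim (\<lambda>n. downs p n y) at_top sequentially"
  unfolding inf_downs_def filterlim_at_top eventually_sequentially
  using downs_mono[OF assms] by (meson order.refl order.trans)

lemma not_inf_ups_eventually_const:
  assumes "walk_path p" "\<not> inf_ups p y"
  shows "\<exists>J. \<forall>\<^sub>F n in sequentially. ups p n y = J"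
proof -
  from assms(2) obtain K where K: "\<And>n. ups p n y < K" unfolding inf_ups_def not_all not_ex not_le by blast
  have fin: "finite (range (\<lambda>n. ups p n y))" by (rule finite_subset[of _ "{..<K}"]) (use K in auto)
  have "Max (range (\<lambda>n. ups p n y)) \<in> range (\<lambda>n. ups p n y)" by (rule Max_in[OF fin]) simp
  then obtain n where n: "ups p n y = Max (range (\<lambda>n. ups p n y))" unfolding image_iff by metis
  have "ups p m y = ups p n y" if "m \<ge> n" for m
    using Max_ge[OF fin, of "ups p m y"] n ups_mono[OF assms(1) that, of y] by auto
  then show ?thesis by (auto simp: eventually_sequentially)
qed

lemma not_inf_downs_eventually_const:
  assumes "walk_path p" "\<not> inf_downs p y"
  shows "\<exists>J. \<forall>\<^sub>F n in sequentially. downs p n y = J"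
proof -
  from assms(2) obtain K where K: "\<And>n. downs p n y < K" unfolding inf_downs_def not_all not_ex not_le by blast
  have fin: "finite (range (\<lambda>n. downs p n y))" by (rule finite_subset[of _ "{..<K}"]) (use K in auto)
  have "Max (range (\<lambda>n. downs p n y)) \<in> range (\<lambda>n. downs p n y)" by (rule Max_in[OF fin]) simp
  then obtain n where n: "downs p n y = Max (range (\<lambda>n. downs p n y))" unfolding image_iff by metis
  have "downs p m y = downs p n y" if "m \<ge> n" for m
    using Max_ge[OF fin, of "downs p m y"] n downs_mono[OF assms(1) that, of y] by auto
  then show ?thesis by (auto simp: eventually_sequentially)
qed

lemma inf_downs_Suc:
  assumes "walk_path p"
  shows "inf_downs p (Suc y) \<longleftrightarrow> inf_ups p y"
proof
  assume "inf_downs p (Suc y)"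
  then show "inf_ups p y" unfolding inf_downs_def inf_ups_def
    using ups_eq_downs[OF assms, of _ y] by (metis le_add1 order.trans)
next
  assume *: "inf_ups p y"
  show "inf_downs p (Suc y)" unfolding inf_downs_def
  proof
    fix K
    obtain n where "Suc K \<le> ups p n y" using * unfolding inf_ups_def by blast
    then have "K \<le> downs p n (Suc y)" using ups_eq_downs[OF assms, of n y] by (simp split: if_splits add: of_bool_def)
    then show "\<exists>n. K \<le> downs p n (Suc y)" by blast
  qed
qed

lemma infinite_visits_iff:
  assumes "walk_path p"
  shows "infinite {n. p n = y} \<longleftrightarrow> inf_ups p y \<or> inf_downs p y"
proof -
  have "infinite {n. p n = y} \<longleftrightarrow> (\<forall>K. \<exists>n. K \<le> ups p n y + downs p n y)"
    unfolding infinite_iff_card_initial ups_plus_downs[OF assms] ..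
  also have "\<dots> \<longleftrightarrow> inf_ups p y \<or> inf_downs p y"
  proof
    assume *: "\<forall>K. \<exists>n. K \<le> ups p n y + downs p n y"
    show "inf_ups p y \<or> inf_downs p y"
    proof (rule ccontr)
      assume "\<not> (inf_ups p y \<or> inf_downs p y)"
      then obtain K L where "\<And>n. ups p n y < K" "\<And>n. downs p n y < L"
        unfolding inf_ups_def inf_downs_def de_Morgan_disj not_all not_ex not_le by blast
      then have "ups p n y + downs p n y < K + L" for n by (simp add: add_strict_mono)
      with * show False by (meson not_le)
    qed
  qed (auto simp: inf_ups_def inf_downs_def intro: trans_le_add1 trans_le_add2)
  finally show ?thesis .
qed

text \<open>
  If every urn draws infinitely often in both directions or in neither, then an up-departure from
  \<open>y\<close> happens infinitely often if and only if one from \<open>y + 1\<close> does, because the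
  down-departures from \<open>y + 1\<close> match the up-departures from \<open>y\<close>. All vertices then
  share the fate of \<open>0\<close>.
\<close>

lemma recurrent_or_transient:
  assumes p: "walk_path p"
    and both: "\<And>y. 0 < y \<Longrightarrow> inf_ups p y \<longleftrightarrow> inf_downs p y"
  shows "infinite {n. p n = y} \<longleftrightarrow> inf_ups p 0"
proof -
  have "inf_ups p y \<longleftrightarrow> inf_ups p 0" for y
    by (induction y) (use both inf_downs_Suc[OF p] in auto)
  moreover have "infinite {n. p n = y} \<longleftrightarrow> inf_ups p y"
  proof (cases y)
    case 0
    then show ?thesis using 0 infinite_visits_iff[OF p] not_inf_downs_0[OF p] by simp
  next
    case (Suc z)
    then show ?thesis using infinite_visits_iff[OF p] both by blast
  qed
  ultimately show ?thesis by simp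
qed

lemma transient_path_at_top:
  assumes "transient_path p"
  shows "filterlim p at_top sequentially"
  unfolding filterlim_at_top
proof
  fix L
  have "finite (\<Union>x<L. {n. p n = x})" using assms by (auto simp: transient_path_def)
  then obtain N where "\<forall>n\<in>(\<Union>x<L. {n. p n = x}). n < N"
    using finite_nat_set_iff_bounded by blast
  then have N: "p n < L \<Longrightarrow> n < N" for n by auto
  show "\<forall>\<^sub>F n in sequentially. L \<le> p n"
    unfolding eventually_sequentially
    using N by (meson not_le)
qed

text \<open>
  Once \<open>y + 1\<close> is no longer left upwards, any later visit to \<open>y\<close> traps the walk at
  or below \<open>y + 1\<close>.
\<close>

lemma no_later_ups:
  assumes p: "walk_path p" and "\<not> inf_ups p (Suc y)" "inf_ups p y" "Suc y \<le> z"
  shows "\<not> inf_ups p z"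
proof -
  obtain J where "\<forall>\<^sub>F n in sequentially. ups p n (Suc y) = J"
    using not_inf_ups_eventually_const[OF p assms(2)] by blast
  then obtain N where N: "\<And>n. n \<ge> N \<Longrightarrow> ups p n (Suc y) = J" by (auto simp: eventually_sequentially)
  have "infinite {n. p n = y}" using infinite_visits_iff[OF p] assms(3) by blast
  then obtain m where m: "m \<ge> N" "p m = y" unfolding infinite_nat_iff_unbounded_le by blast
  have le: "p n \<le> Suc y" if "n \<ge> m" for n
    using that
  proof (induction rule: dec_induct)
    case (step n)
    have "ups p (Suc n) (Suc y) = ups p n (Suc y)" using N step m by simp
    then have "\<not> (p n = Suc y \<and> p (Suc n) = Suc (Suc y))" by (simp add: ups_Suc[OF p])
    moreover have "p (Suc n) = Suc (p n) \<or> p n = Suc (p (Suc n))"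
      using p by (simp add: walk_path_def)
    ultimately show ?case using step by linarith
  qed (use m in simp)
  have "ups p n z = ups p m z" if "n \<ge> m" for n
    using that
  proof (induction rule: dec_induct)
    case (step n)
    have "\<not> (p n = z \<and> p (Suc n) = Suc z)" using le[of "Suc n"] step assms(4) by auto
    then show ?case using step by (simp add: ups_Suc[OF p])
  qed simp
  then have "ups p n z \<le> ups p m z" for n
    by (metis ups_mono[OF p] nle_le)
  then have "\<not> Suc (ups p m z) \<le> ups p n z" for n by (simp add: not_le le_imp_less_Suc)
  then show ?thesis unfolding inf_ups_def by blast
qed

text \<open>
  Some edge is crossed infinitely often because the path is bounded. Fixation of the urn at its upper end
  stops all up-departures from there, and the trapping argument excludes a second such edge on either side.
\<close>

lemma single_edge_if_fixation:
  assumes p: "walk_path p" and bounded: "\<And>n. p n \<le> N"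
    and fixated: "\<And>y. 0 < y \<Longrightarrow> \<not> (inf_ups p y \<and> inf_downs p y)"
  shows "localizes_on_single_edge p"
proof -
  have "(\<Union>x\<le>N. {n. p n = x}) = UNIV" using bounded by auto
  then have "infinite (\<Union>x\<le>N. {n. p n = x})" by simp
  then obtain x where x: "infinite {n. p n = x}" by auto
  have "\<exists>y. inf_ups p y"
  proof (cases x)
    case 0
    then show ?thesis using 0 x infinite_visits_iff[OF p] not_inf_downs_0[OF p] by blast
  next
    case (Suc z)
    then show ?thesis using x infinite_visits_iff[OF p] inf_downs_Suc[OF p] by blast
  qed
  then obtain y where y: "inf_ups p y" ..
  have up: "\<not> inf_ups p (Suc z)" if "inf_ups p z" for z
    using fixated[of "Suc z"] that inf_downs_Suc[OF p] by blast
  have uniq: "z = y" if "inf_ups p z" for z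
    using no_later_ups[OF p up[OF y] y, of z] no_later_ups[OF p up[OF that] that, of y] that y
    by (metis not_less_eq_eq linorder_not_le le_antisym)
  have "infinite {n. p n = z} \<longleftrightarrow> z = y \<or> z = Suc y" for z
  proof (cases z)
    case 0
    then show ?thesis using 0 infinite_visits_iff[OF p, of 0] not_inf_downs_0[OF p] uniq[of 0] y by (metis nat.distinct(1))
  next
    case (Suc w)
    then show ?thesis
      using infinite_visits_iff[OF p, of z] inf_downs_Suc[OF p, of w] uniq y by (metis nat.inject)
  qed
  then show ?thesis by (auto simp: localizes_on_single_edge_def visited_inf_often_def)
qed

section \<open>Functionals of an initial segment\<close>

text \<open>
  Such a functional takes finitely many values on the paths of the walk. All integrability and measurability
  questions below reduce to this.
\<close>

definition depends_upto :: "nat \<Rightarrow> ((nat \<Rightarrow> nat) \<Rightarrow> 'b) \<Rightarrow> bool" where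
  "depends_upto n g \<longleftrightarrow> (\<forall>p q. (\<forall>i\<le>n. p i = q i) \<longrightarrow> g p = g q)"

lemma urn_state_cong: "(\<And>i. i \<le> n \<Longrightarrow> p i = q i) \<Longrightarrow> urn_state p n = urn_state q n"
  by (induction n) auto

lemma frozen_cong: "(\<And>i. i \<le> n \<Longrightarrow> p i = q i) \<Longrightarrow> frozen B p n = frozen B q n"
proof (induction n)
  case (Suc n)
  then have "frozen B p n = frozen B q n" by simp
  moreover have "urn_state p (Suc n) = urn_state q (Suc n)" by (rule urn_state_cong) (use Suc in auto)
  ultimately show ?case by (simp del: urn_state.simps)
qed simp

lemma depends_upto_urn_state [intro]: "depends_upto n (\<lambda>p. h (urn_state p n))"
  unfolding depends_upto_def using urn_state_cong[of n] by metis

lemma depends_upto_frozen [intro]: "depends_upto n (\<lambda>p. h (frozen B p n))"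
  unfolding depends_upto_def using frozen_cong[of n] by metis

lemma depends_upto_combine:
  "depends_upto n g \<Longrightarrow> depends_upto n h \<Longrightarrow> depends_upto n (\<lambda>p. F (g p) (h p))"
  unfolding depends_upto_def by metis

lemma finite_image_walk_path:
  assumes "depends_upto n g"
  shows "finite (g ` {p. walk_path p})"
proof -
  let ?F = "{q. \<forall>i. (i \<in> {..n} \<longrightarrow> q i \<in> {..n}) \<and> (i \<notin> {..n} \<longrightarrow> q i = 0)} :: (nat \<Rightarrow> nat) set"
  have "g p \<in> g ` ?F" if "walk_path p" for p
  proof (rule image_eqI)
    show "g p = g (\<lambda>i. if i \<le> n then p i else 0)"
      using assms by (auto simp: depends_upto_def)
    show "(\<lambda>i. if i \<le> n then p i else 0) \<in> ?F"
      using walk_path_le[OF that] by (auto intro: order_trans)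
  qed
  then have sub: "g ` {p. walk_path p} \<subseteq> g ` ?F" by blast
  have "finite ?F" by (rule finite_set_of_finite_funs) auto
  then have "finite (g ` ?F)" by (rule finite_imageI)
  with sub show ?thesis by (rule finite_subset)
qed

text \<open>
  Only countably many initial segments of a path exist, so every functional of the initial segment is
  measurable with respect to it.
\<close>

lemma measurable_history:
  fixes g :: "(nat \<Rightarrow> nat) \<Rightarrow> real"
  assumes X: "\<And>n. X n \<in> measurable M (count_space UNIV)" and g: "depends_upto n g"
  shows "(\<lambda>\<omega>. g (\<lambda>i. X i \<omega>)) \<in> borel_measurable (history M X n)"
proof -
  let ?L = "\<lambda>\<omega>. map (\<lambda>i. X i \<omega>) [0..<Suc n]"
  have sp: "space (history M X n) = space M"
    using subalgebra_history[OF X] by (simp add: subalgebra_def)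
  have mX: "{\<omega> \<in> space M. X i \<omega> = v} \<in> sets (history M X n)" if "i \<le> n" for i v
  proof -
    have "X i -` {v} \<inter> space M \<in> sets (history M X n)"
      unfolding history_def using that by (subst sets_measure_of) auto
    then show ?thesis by (simp add: vimage_def Int_def conj_commute)
  qed
  have "?L \<in> measurable (history M X n) (count_space UNIV)"
    unfolding measurable_count_space_eq2_countable
  proof (intro conjI ballI)
    fix l :: "nat list"
    show "?L -` {l} \<inter> space (history M X n) \<in> sets (history M X n)"
    proof (cases "length l = Suc n")
      case True
      have "?L -` {l} \<inter> space (history M X n) = {\<omega> \<in> space M. \<forall>i\<in>{..n}. X i \<omega> = l ! i}"
        using True sp by (auto simp: list_eq_iff_nth_eq less_Suc_eq_le simp del: upt_Suc)
      also have "\<dots> = (\<Inter>i\<in>{..n}. {\<omega> \<in> space M. X i \<omega> = l ! i})" by auto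
      also have "\<dots> \<in> sets (history M X n)" using mX by (intro sets.finite_INT) auto
      finally show ?thesis .
    next
      case False
      then have "?L -` {l} \<inter> space (history M X n) = {}" by auto
      then show ?thesis by simp
    qed
  qed auto
  then have "(\<lambda>\<omega>. (\<lambda>l. g (\<lambda>i. if i \<le> n then l ! i else 0)) (?L \<omega>)) \<in> borel_measurable (history M X n)"
    by (rule measurable_compose) simp
  also have "(\<lambda>\<omega>. (\<lambda>l. g (\<lambda>i. if i \<le> n then l ! i else 0)) (?L \<omega>)) = (\<lambda>\<omega>. g (\<lambda>i. X i \<omega>))"
    using g unfolding depends_upto_def by (intro ext) (auto simp del: upt_Suc simp: less_Suc_eq_le)
  finally show ?thesis .
qed

lemma (in prob_space) integrable_path_functional:
  fixes g :: "(nat \<Rightarrow> nat) \<Rightarrow> real"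
  assumes meas: "\<And>n. X n \<in> measurable M (count_space UNIV)"
    and path: "AE \<omega> in M. walk_path (\<lambda>n. X n \<omega>)" and g: "depends_upto n g"
  shows "integrable M (\<lambda>\<omega>. g (\<lambda>i. X i \<omega>))"
proof (rule integrable_const_bound)
  have fin: "finite ((\<lambda>p. norm (g p)) ` {p. walk_path p})"
    using finite_imageI[OF finite_image_walk_path[OF g], of norm] by (simp add: image_image)
  show "AE \<omega> in M. norm (g (\<lambda>i. X i \<omega>)) \<le> Max ((\<lambda>p. norm (g p)) ` {p. walk_path p})"
    using path by eventually_elim (rule Max_ge[OF fin], auto)
  show "(\<lambda>\<omega>. g (\<lambda>i. X i \<omega>)) \<in> borel_measurable M"
    by (rule measurable_from_subalg[OF subalgebra_history measurable_history[OF _ g]]) (rule meas)+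
qed

section \<open>Means of the stopped urn walk\<close>

text \<open>
  The walk with a general initial weight \<open>c (y + 1)\<close> of the edge above \<open>y\<close> and a
  general reinforcement factor \<open>d\<close> that counts departures from a vertex instead of crossings of
  an edge. The value \<open>c 0 = 0\<close> forbids the step down from \<open>0\<close>. The step
  probability enters in integrated form, because every argument below concerns means at fixed times.
\<close>

locale urn_walk = prob_space M
  for M :: "'a measure" +
  fixes X :: "nat \<Rightarrow> 'a \<Rightarrow> nat" and c d :: "nat \<Rightarrow> real"
  assumes measurable_X: "\<And>n. X n \<in> measurable M (count_space UNIV)"
    and AE_walk_path: "AE \<omega> in M. walk_path (\<lambda>n. X n \<omega>)"
    and c_0: "c 0 = 0" and c_pos: "\<And>y. 0 < c (Suc y)"
    and d_pos: "\<And>i. 0 < d i" and d_mono: "mono d"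
    and expectation_up: "\<And>n g. depends_upto n (g :: _ \<Rightarrow> real) \<Longrightarrow>
      expectation (\<lambda>\<omega>. g (\<lambda>i. X i \<omega>) * of_bool (X (Suc n) \<omega> = Suc (X n \<omega>))) =
      expectation (\<lambda>\<omega>. g (\<lambda>i. X i \<omega>) * (case urn_state (\<lambda>i. X i \<omega>) n of (x, k, j) \<Rightarrow>
        c (Suc x) * d (k x) / (c (Suc x) * d (k x) + c x * d (j x))))"
begin

abbreviation traj :: "'a \<Rightarrow> nat \<Rightarrow> nat" where
  "traj \<omega> \<equiv> (\<lambda>i. X i \<omega>)"

definition up_prob :: "urn_config \<Rightarrow> real" where
  "up_prob = (\<lambda>(x, k, j). c (Suc x) * d (k x) / (c (Suc x) * d (k x) + c x * d (j x)))"

definition transition :: "(urn_config \<Rightarrow> real) \<Rightarrow> urn_config \<Rightarrow> real" where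
  "transition H s = up_prob s * H (up_state s) + (1 - up_prob s) * H (down_state s)"

definition stopped_expectation ::
    "(urn_config \<Rightarrow> bool) \<Rightarrow> nat \<Rightarrow> (urn_config \<Rightarrow> real) \<Rightarrow> real" where
  "stopped_expectation B n H = expectation (\<lambda>\<omega>. H (frozen B (traj \<omega>) n))"

lemma c_nonneg: "0 \<le> c y"
  by (cases y) (auto simp: c_0 intro: less_imp_le[OF c_pos])

lemma c_pos': "0 < y \<Longrightarrow> 0 < c y"
  by (cases y) (auto simp: c_pos)

lemma up_prob_bounds: "0 \<le> up_prob s" "up_prob s \<le> 1"
proof -
  obtain x k j where s: "s = (x, k, j)" by (cases s)
  have "0 < c (Suc x) * d (k x)" "0 \<le> c x * d (j x)"
    using c_pos d_pos c_nonneg by (auto simp: less_imp_le)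
  then show "0 \<le> up_prob s" "up_prob s \<le> 1" by (auto simp: s up_prob_def field_simps)
qed

lemma integrable_path:
  fixes g :: "(nat \<Rightarrow> nat) \<Rightarrow> real"
  assumes "depends_upto n g"
  shows "integrable M (\<lambda>\<omega>. g (traj \<omega>))"
  by (rule integrable_path_functional[OF measurable_X AE_walk_path assms])

lemma integrable_frozen: "integrable M (\<lambda>\<omega>. (H :: _ \<Rightarrow> real) (frozen B (traj \<omega>) n))"
  by (rule integrable_path[OF depends_upto_frozen])

lemma sets_frozen: "{\<omega> \<in> space M. P (frozen B (traj \<omega>) n)} \<in> sets M"
proof -
  have "(\<lambda>\<omega>. of_bool (P (frozen B (traj \<omega>) n)) :: real) \<in> borel_measurable M"
    by (rule borel_measurable_integrable[OF integrable_path[OF depends_upto_frozen]])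
  then have "{\<omega> \<in> space M. (of_bool (P (frozen B (traj \<omega>) n)) :: real) \<ge> 1} \<in> sets M"
    by (intro borel_measurable_le) auto
  also have "{\<omega> \<in> space M. (of_bool (P (frozen B (traj \<omega>) n)) :: real) \<ge> 1} =
      {\<omega> \<in> space M. P (frozen B (traj \<omega>) n)}" by auto
  finally show ?thesis .
qed

text \<open>
  The one-step equation from which every martingale property follows: up to time \<open>n\<close> all terms
  are functionals of the history, so the indicator of an up-step may be replaced by its conditional
  probability.
\<close>

lemma stopped_expectation_Suc:
  "stopped_expectation B (Suc n) H =
   stopped_expectation B n (\<lambda>s. if B s then H s else transition H s)"
proof -
  define g0 where "g0 p = (if B (frozen B p n) then H (frozen B p n) else 0)" for p
  define g1 where "g1 p = (if B (frozen B p n) then 0 else H (up_state (urn_state p n)))" for p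
  define g2 where "g2 p = (if B (frozen B p n) then 0 else H (down_state (urn_state p n)))" for p
  have "depends_upto n (\<lambda>p. (frozen B p n, urn_state p n))"
    by (rule depends_upto_combine[of n _ _ Pair])
      (use depends_upto_frozen[of n id] depends_upto_urn_state[of n id] in auto)
  then have "depends_upto n (\<lambda>p. h (frozen B p n, urn_state p n))" for h :: "_ \<Rightarrow> real"
    unfolding depends_upto_def by metis
  from this[of "\<lambda>(a, b). (if B a then H a else 0) + (if B a then 0 else H (down_state b))"]
    this[of "\<lambda>(a, b). (if B a then 0 else H (up_state b)) - (if B a then 0 else H (down_state b))"]
    this[of "\<lambda>(a, b). ((if B a then 0 else H (up_state b)) - (if B a then 0 else H (down_state b))) * up_prob b"]
  have dep: "depends_upto n (\<lambda>p. g0 p + g2 p)" "depends_upto n (\<lambda>p. g1 p - g2 p)"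
    "depends_upto n (\<lambda>p. (g1 p - g2 p) * up_prob (urn_state p n))"
    by (simp_all add: g0_def g1_def g2_def)
  have "depends_upto (Suc n) (\<lambda>p. (g1 p - g2 p) * of_bool (p (Suc n) = Suc (p n)))"
    by (rule depends_upto_combine[of _ _ _ "(*)"])
      (use dep(2) in \<open>auto simp: depends_upto_def\<close>)
  note int = integrable_path[OF dep(1)] integrable_path[OF dep(2)] integrable_path[OF dep(3)]
    integrable_path[OF this]
  have "stopped_expectation B (Suc n) H =
      expectation (\<lambda>\<omega>. (g0 (traj \<omega>) + g2 (traj \<omega>)) +
        (g1 (traj \<omega>) - g2 (traj \<omega>)) * of_bool (X (Suc n) \<omega> = Suc (X n \<omega>)))"
    unfolding stopped_expectation_def
    by (intro Bochner_Integration.integral_cong)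
      (auto simp: g0_def g1_def g2_def dest: frozen_unstopped)
  also have "\<dots> = expectation (\<lambda>\<omega>. g0 (traj \<omega>) + g2 (traj \<omega>)) +
      expectation (\<lambda>\<omega>. (g1 (traj \<omega>) - g2 (traj \<omega>)) * up_prob (urn_state (traj \<omega>) n))"
    using int(1,4) expectation_up[OF dep(2)]
    by (simp add: up_prob_def)
  also have "\<dots> = expectation (\<lambda>\<omega>. (g0 (traj \<omega>) + g2 (traj \<omega>)) +
      (g1 (traj \<omega>) - g2 (traj \<omega>)) * up_prob (urn_state (traj \<omega>) n))"
    using int(1,3) by simp
  also have "\<dots> = stopped_expectation B n (\<lambda>s. if B s then H s else transition H s)"
    unfolding stopped_expectation_def
    by (intro Bochner_Integration.integral_cong)
      (auto simp: g0_def g1_def g2_def transition_def algebra_simps dest: frozen_unstopped)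
  finally show ?thesis .
qed

lemma stopped_expectation_mono:
  assumes "\<And>p. walk_path p \<Longrightarrow> H (frozen B p n) \<le> K (frozen B p n)"
  shows "stopped_expectation B n H \<le> stopped_expectation B n K"
  unfolding stopped_expectation_def
proof (rule integral_mono_AE)
  show "AE \<omega> in M. H (frozen B (traj \<omega>) n) \<le> K (frozen B (traj \<omega>) n)"
    using AE_walk_path by eventually_elim (rule assms)
qed (rule integrable_frozen)+

lemma stopped_expectation_cong:
  assumes "\<And>p. walk_path p \<Longrightarrow> H (frozen B p n) = K (frozen B p n)"
  shows "stopped_expectation B n H = stopped_expectation B n K"
  by (intro antisym stopped_expectation_mono) (simp_all add: assms)

lemma stopped_expectation_const [simp]: "stopped_expectation B n (\<lambda>_. a) = a"
  by (simp add: stopped_expectation_def prob_space)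

lemma stopped_expectation_add:
  "stopped_expectation B n (\<lambda>s. H s + K s) = stopped_expectation B n H + stopped_expectation B n K"
  unfolding stopped_expectation_def
  by (rule Bochner_Integration.integral_add) (rule integrable_frozen)+

lemma stopped_expectation_diff:
  "stopped_expectation B n (\<lambda>s. H s - K s) = stopped_expectation B n H - stopped_expectation B n K"
  unfolding stopped_expectation_def
  by (rule Bochner_Integration.integral_diff) (rule integrable_frozen)+

lemma stopped_expectation_cmult:
  "stopped_expectation B n (\<lambda>s. a * H s) = a * stopped_expectation B n H"
  unfolding stopped_expectation_def by simp

lemma stopped_expectation_divide:
  "stopped_expectation B n (\<lambda>s. H s / a) = stopped_expectation B n H / a"
  unfolding stopped_expectation_def by simp

lemma stopped_expectation_sum:
  "stopped_expectation B n (\<lambda>s. \<Sum>y\<in>A. H y s) = (\<Sum>y\<in>A. stopped_expectation B n (H y))"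
  unfolding stopped_expectation_def
  by (rule Bochner_Integration.integral_sum) (rule integrable_frozen)

lemma stopped_expectation_of_bool:
  "stopped_expectation B n (\<lambda>s. of_bool (P s)) = prob {\<omega> \<in> space M. P (frozen B (traj \<omega>) n)}"
proof -
  have "stopped_expectation B n (\<lambda>s. of_bool (P s)) =
      expectation (indicator {\<omega> \<in> space M. P (frozen B (traj \<omega>) n)})"
    unfolding stopped_expectation_def
    by (intro Bochner_Integration.integral_cong) (auto simp: indicator_def)
  also have "\<dots> = prob {\<omega> \<in> space M. P (frozen B (traj \<omega>) n)}"
    using sets_frozen by (simp add: Int_absorb1)
  finally show ?thesis .
qed

lemma stopped_expectation_0:
  "stopped_expectation B 0 H = H (0, (\<lambda>_. 0), (\<lambda>_. 0))"
proof -
  have "stopped_expectation B 0 H = stopped_expectation B 0 (\<lambda>_. H (0, (\<lambda>_. 0), (\<lambda>_. 0)))"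
    by (rule stopped_expectation_cong) (simp add: walk_path_def)
  then show ?thesis by simp
qed

lemma stopped_supermartingale:
  assumes "\<And>s. consistent s \<Longrightarrow> \<not> B s \<Longrightarrow> transition H s \<le> H s"
  shows "stopped_expectation B n H \<le> H (0, (\<lambda>_. 0), (\<lambda>_. 0))"
proof (induction n)
  case (Suc n)
  have "stopped_expectation B (Suc n) H \<le> stopped_expectation B n H"
    unfolding stopped_expectation_Suc
    by (rule stopped_expectation_mono) (use assms consistent_frozen in auto)
  with Suc show ?case by simp
qed (simp add: stopped_expectation_0)

lemma stopped_martingale:
  assumes "\<And>s. transition H s = H s"
  shows "stopped_expectation B n H = H (0, (\<lambda>_. 0), (\<lambda>_. 0))"
proof (induction n)
  case (Suc n)
  have "stopped_expectation B (Suc n) H = stopped_expectation B n H"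
    unfolding stopped_expectation_Suc by (rule stopped_expectation_cong) (simp add: assms)
  with Suc show ?case by simp
qed (simp add: stopped_expectation_0)

text \<open>
  The form in which limits in time are taken: an event that forces events of arbitrarily small probability
  to hold from some time on is negligible.
\<close>

lemma AE_not_if_rarely:
  assumes meas: "\<And>\<epsilon> n. \<epsilon> > 0 \<Longrightarrow> A \<epsilon> n \<in> sets M"
    and small: "\<And>\<epsilon> n. \<epsilon> > 0 \<Longrightarrow> prob (A \<epsilon> n) \<le> (\<epsilon> :: real)"
    and ev: "AE \<omega> in M. \<forall>\<epsilon>>0. Q \<omega> \<longrightarrow> eventually (\<lambda>n. \<omega> \<in> A \<epsilon> n) sequentially"
  shows "AE \<omega> in M. \<not> Q \<omega>"
proof -
  define L where "L \<epsilon> N = (\<Inter>n\<in>{N..}. A \<epsilon> n)" for \<epsilon> N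
  have L: "L \<epsilon> N \<in> sets M" if "\<epsilon> > 0" for \<epsilon> N
    unfolding L_def using meas[OF that] by (intro sets.countable_INT') auto
  have prob_U: "prob (\<Union>N. L \<epsilon> N) \<le> \<epsilon>" if "\<epsilon> > 0" for \<epsilon>
  proof (rule LIMSEQ_le_const2)
    show "(\<lambda>N. prob (L \<epsilon> N)) \<longlonglongrightarrow> prob (\<Union>N. L \<epsilon> N)"
      by (rule finite_Lim_measure_incseq) (auto simp: incseq_def L_def intro!: L[unfolded L_def] that)
    have "prob (L \<epsilon> N) \<le> \<epsilon>" for N
      by (rule order_trans[OF finite_measure_mono small[OF that, of N]])
        (auto simp: L_def intro: meas that)
    then show "\<exists>N. \<forall>n\<ge>N. prob (L \<epsilon> n) \<le> \<epsilon>" by auto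
  qed
  define Z where "Z = (\<Inter>i. \<Union>N. L (1 / real (Suc i)) N)"
  have Z: "Z \<in> sets M" unfolding Z_def using L by (intro sets.countable_INT') (auto simp del: of_nat_Suc)
  have "prob Z \<le> 0"
  proof (rule LIMSEQ_le_const)
    show "(\<lambda>i. 1 / real (Suc i)) \<longlonglongrightarrow> 0" by (rule LIMSEQ_Suc[OF lim_1_over_n])
    have "prob Z \<le> 1 / real (Suc i)" for i
      by (rule order_trans[OF finite_measure_mono prob_U])
        (use L in \<open>auto simp: Z_def simp del: of_nat_Suc\<close>)
    then show "\<exists>N. \<forall>n\<ge>N. prob Z \<le> 1 / real (Suc n)" by auto
  qed
  then have "AE \<omega> in M. \<omega> \<notin> Z"
    using Z by (intro AE_not_in) (auto simp: null_sets_def emeasure_eq_measure measure_le_0_iff)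
  with ev show ?thesis
  proof eventually_elim
    case (elim \<omega>)
    show ?case
    proof
      assume "Q \<omega>"
      have "\<exists>N. \<omega> \<in> L (1 / real (Suc i)) N" for i
      proof -
        have "eventually (\<lambda>n. \<omega> \<in> A (1 / real (Suc i)) n) sequentially"
          using elim(1) \<open>Q \<omega>\<close> by (simp del: of_nat_Suc)
        then show ?thesis by (auto simp: eventually_sequentially L_def)
      qed
      then have "\<omega> \<in> Z" by (auto simp: Z_def)
      with elim(2) show False by simp
    qed
  qed
qed

text \<open>
  Markov's inequality at fixed times stands in for the martingale convergence theorem.
\<close>

lemma nonneg_martingale_not_to_infinity:
  assumes nonneg: "\<And>p n. walk_path p \<Longrightarrow> 0 \<le> H (urn_state p n)"
    and mart: "\<And>s. transition H s = H s"
    and init: "H (0, (\<lambda>_. 0), (\<lambda>_. 0)) = 1"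
  shows "AE \<omega> in M. \<not> filterlim (\<lambda>n. H (urn_state (traj \<omega>) n)) at_top sequentially"
proof (rule AE_not_if_rarely[where A = "\<lambda>\<epsilon> n. {\<omega> \<in> space M. H (frozen (\<lambda>_. False) (traj \<omega>) n) \<ge> 1 / \<epsilon>}"])
  fix \<epsilon> :: real and n assume \<epsilon>: "\<epsilon> > 0"
  show "{\<omega> \<in> space M. H (frozen (\<lambda>_. False) (traj \<omega>) n) \<ge> 1 / \<epsilon>} \<in> sets M"
    by (rule sets_frozen)
  have "stopped_expectation (\<lambda>_. False) n (\<lambda>s. of_bool (1 / \<epsilon> \<le> H s)) \<le>
      stopped_expectation (\<lambda>_. False) n (\<lambda>s. \<epsilon> * H s)"
    by (rule stopped_expectation_mono) (use \<epsilon> nonneg in \<open>auto simp: field_simps of_bool_def\<close>)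
  also have "\<dots> = \<epsilon>"
    by (simp add: stopped_expectation_cmult stopped_martingale[OF mart] init)
  finally show "prob {\<omega> \<in> space M. H (frozen (\<lambda>_. False) (traj \<omega>) n) \<ge> 1 / \<epsilon>} \<le> \<epsilon>"
    by (simp only: stopped_expectation_of_bool)
next
  show "AE \<omega> in M. \<forall>\<epsilon>>0. filterlim (\<lambda>n. H (urn_state (traj \<omega>) n)) at_top sequentially \<longrightarrow>
      (\<forall>\<^sub>F n in sequentially. \<omega> \<in> {\<omega> \<in> space M. H (frozen (\<lambda>_. False) (traj \<omega>) n) \<ge> 1 / \<epsilon>})"
    by (rule AE_I2) (auto simp: filterlim_at_top)
qed

end

section \<open>Martingales of the urns\<close>

context urn_walk
begin

definition inv_sum :: "nat \<Rightarrow> real" where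
  "inv_sum k = (\<Sum>i<k. 1 / d i)"

definition inv_sq_sum :: "nat \<Rightarrow> real" where
  "inv_sq_sum k = (\<Sum>i<k. 1 / (d i)\<^sup>2)"

text \<open>
  A function is invariant under a step if its increments in the two directions balance with respect to the
  weights.
\<close>

lemma transition_unchanged:
  assumes "s = (x, k, j)" "H (up_state s) = H s + \<alpha>" "H (down_state s) = H s + \<beta>"
    and "c (Suc x) * d (k x) * \<alpha> + c x * d (j x) * \<beta> = 0"
  shows "transition H s = H s"
proof -
  define u v where "u = c (Suc x) * d (k x)" and "v = c x * d (j x)"
  have "0 < u" "0 \<le> v"
    unfolding u_def v_def using c_pos d_pos c_nonneg by (auto simp: less_imp_le)
  then have pos: "u + v > 0" by linarith
  have q: "up_prob s = u / (u + v)" by (simp add: assms(1) up_prob_def u_def v_def)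
  have "transition H s = H s + (up_prob s * \<alpha> + (1 - up_prob s) * \<beta>)"
    unfolding transition_def assms(2,3) by (simp add: algebra_simps)
  also have "up_prob s * \<alpha> + (1 - up_prob s) * \<beta> = (u * \<alpha> + v * \<beta>) / (u + v)"
  proof -
    have "u + v \<noteq> 0" using pos by simp
    then have "1 - u / (u + v) = v / (u + v)" by (simp add: field_simps)
    then show ?thesis unfolding q by (simp add: add_divide_distrib)
  qed
  also have "u * \<alpha> + v * \<beta> = 0" using assms(4) by (simp add: u_def v_def)
  finally show ?thesis by simp
qed

text \<open>
  If the departures from \<open>y\<close> were the rings of two clocks that wait \<open>1 / (c (y + 1) * d
  i)\<close> and \<open>1 / (c y * d i)\<close> on average before each ring, this would be the difference of
  the times that the two clocks need on average for the rings seen so far.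
\<close>

definition urn_gap :: "nat \<Rightarrow> urn_config \<Rightarrow> real" where
  "urn_gap y = (\<lambda>(x, k, j). inv_sum (k y) / c (Suc y) - inv_sum (j y) / c y)"

definition urn_gap_var :: "nat \<Rightarrow> urn_config \<Rightarrow> real" where
  "urn_gap_var y = (\<lambda>(x, k, j). inv_sq_sum (k y) / (c (Suc y))\<^sup>2 + inv_sq_sum (j y) / (c y)\<^sup>2)"

lemma urn_gap_up:
  "urn_gap y (up_state (x, k, j)) = urn_gap y (x, k, j) + (if y = x then 1 / (c (Suc x) * d (k x)) else 0)"
  by (auto simp: urn_gap_def inv_sum_def add_divide_distrib)

lemma urn_gap_down:
  "urn_gap y (down_state (x, k, j)) = urn_gap y (x, k, j) - (if y = x then 1 / (c x * d (j x)) else 0)"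
  by (auto simp: urn_gap_def inv_sum_def add_divide_distrib)

lemma urn_gap_var_up:
  "urn_gap_var y (up_state (x, k, j)) =
    urn_gap_var y (x, k, j) + (if y = x then 1 / (c (Suc x) * d (k x))\<^sup>2 else 0)"
  by (auto simp: urn_gap_var_def inv_sq_sum_def add_divide_distrib power_mult_distrib)

lemma urn_gap_var_down:
  "urn_gap_var y (down_state (x, k, j)) =
    urn_gap_var y (x, k, j) + (if y = x then 1 / (c x * d (j x))\<^sup>2 else 0)"
  by (auto simp: urn_gap_var_def inv_sq_sum_def add_divide_distrib power_mult_distrib)

lemma transition_urn_gap:
  assumes "0 < y"
  shows "transition (urn_gap y) s = urn_gap y s"
proof -
  obtain x k j where s: "s = (x, k, j)" by (cases s)
  show ?thesis
    using c_pos' [OF assms] c_pos[of x] d_pos[of "k x"] d_pos[of "j x"]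
    by (intro transition_unchanged[OF s, where \<alpha> = "if y = x then 1 / (c (Suc x) * d (k x)) else 0"
          and \<beta> = "- (if y = x then 1 / (c x * d (j x)) else 0)"])
      (auto simp: s urn_gap_up urn_gap_down simp del: up_state.simps down_state.simps)
qed

lemma expectation_urn_gap:
  assumes "0 < y"
  shows "stopped_expectation B n (urn_gap y) = 0"
  by (subst stopped_martingale[OF transition_urn_gap[OF assms]]) (simp add: urn_gap_def inv_sum_def)

text \<open>
  Only the gap of the current vertex moves, so the increments of the square of the sum exceed those of the
  squared jumps by multiples of a fair increment; no mixed terms between different urns arise.
\<close>

lemma transition_square:
  defines "S \<equiv> \<lambda>L s. \<Sum>y\<in>{1..L}. urn_gap y s" and "Q \<equiv> \<lambda>L s. \<Sum>y\<in>{1..L}. urn_gap_var y s"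
  shows "transition (\<lambda>s. (S L s)\<^sup>2 - Q L s) s = (S L s)\<^sup>2 - Q L s"
proof -
  obtain x k j where s: "s = (x, k, j)" by (cases s)
  define u v where "u = c (Suc x) * d (k x)" and "v = c x * d (j x)"
  define b :: real where "b = (if x \<in> {1..L} then 1 else 0)"
  have v: "v \<noteq> 0" if "x \<in> {1..L}"
    using that c_pos'[of x] d_pos[of "j x"] by (auto simp: v_def)
  have u: "u \<noteq> 0" using c_pos[of x] d_pos[of "k x"] by (auto simp: u_def)
  have S: "S L (up_state s) = S L s + b / u" "S L (down_state s) = S L s - b / v"
    and Q: "Q L (up_state s) = Q L s + b / u\<^sup>2" "Q L (down_state s) = Q L s + b / v\<^sup>2"
    unfolding s S_def Q_def urn_gap_up urn_gap_down urn_gap_var_up urn_gap_var_down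
    by (auto simp: sum.distrib sum_subtractf b_def u_def v_def simp del: up_state.simps down_state.simps)
  have b2: "b\<^sup>2 = b" by (simp add: b_def)
  show ?thesis
  proof (rule transition_unchanged[OF s, where \<alpha> = "2 * S L s * b / u" and \<beta> = "- 2 * S L s * b / v"])
    show "(S L (up_state s))\<^sup>2 - Q L (up_state s) = (S L s)\<^sup>2 - Q L s + 2 * S L s * b / u"
      unfolding S Q using b2 by (simp add: power2_sum power_divide)
    show "(S L (down_state s))\<^sup>2 - Q L (down_state s) = (S L s)\<^sup>2 - Q L s + - 2 * S L s * b / v"
      unfolding S Q using b2 by (simp add: power2_diff power_divide)
    show "c (Suc x) * d (k x) * (2 * S L s * b / u) + c x * d (j x) * (- 2 * S L s * b / v) = 0"
      unfolding u_def[symmetric] v_def[symmetric] using u v by (auto simp: b_def)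
  qed
qed

lemma expectation_gap_square:
  "stopped_expectation B n (\<lambda>s. (\<Sum>y\<in>{1..L}. urn_gap y s)\<^sup>2) =
   (\<Sum>y\<in>{1..L}. stopped_expectation B n (urn_gap_var y))"
proof -
  have "stopped_expectation B n (\<lambda>s. (\<Sum>y\<in>{1..L}. urn_gap y s)\<^sup>2 - (\<Sum>y\<in>{1..L}. urn_gap_var y s)) = 0"
    by (subst stopped_martingale[OF transition_square])
      (simp add: urn_gap_def urn_gap_var_def inv_sum_def inv_sq_sum_def)
  then show ?thesis by (simp add: stopped_expectation_diff stopped_expectation_sum)
qed

text \<open>
  In the picture of the exponential clocks and for small \<open>z\<close> this is, up to a deterministic
  factor, the conditional expectation of \<open>exp (z * (T - S))\<close> given the draws so far, where
  \<open>T\<close> and \<open>S\<close> are the times at which the down-clock and the up-clock have rung a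
  large fixed number of times.
\<close>

definition exp_martingale :: "complex \<Rightarrow> nat \<Rightarrow> urn_config \<Rightarrow> complex" where
  "exp_martingale z y = (\<lambda>(x, k, j). (\<Prod>i<k y. 1 + z / of_real (c (Suc y) * d i)) *
     (\<Prod>i<j y. 1 - z / of_real (c y * d i)))"

lemma transition_exp_martingale:
  assumes "0 < y"
  shows "transition (\<lambda>s. Re (w * exp_martingale z y s)) s = Re (w * exp_martingale z y s)"
proof -
  obtain x k j where s: "s = (x, k, j)" by (cases s)
  define u v where "u = c (Suc x) * d (k x)" and "v = c x * d (j x)"
  define b :: real where "b = (if y = x then 1 else 0)"
  have v: "v \<noteq> 0" if "y = x"
    using that assms c_pos'[of x] d_pos[of "j x"] by (auto simp: v_def)
  have u: "u \<noteq> 0" using c_pos[of x] d_pos[of "k x"] by (auto simp: u_def)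
  define W where "W = Re (w * exp_martingale z y s * z)"
  have Re: "Re (q * of_real r) = Re q * r" for q r by simp
  show ?thesis
  proof (rule transition_unchanged[OF s, where \<alpha> = "W * (b / u)" and \<beta> = "- (W * (b / v))"])
    have "w * exp_martingale z y (up_state s) =
        w * exp_martingale z y s + w * exp_martingale z y s * z * of_real (b / u)"
      by (auto simp: s exp_martingale_def b_def u_def algebra_simps)
    then show "Re (w * exp_martingale z y (up_state s)) = Re (w * exp_martingale z y s) + W * (b / u)"
      by (simp only: W_def plus_complex.sel Re)
    have "w * exp_martingale z y (down_state s) =
        w * exp_martingale z y s - w * exp_martingale z y s * z * of_real (b / v)"
      by (auto simp: s exp_martingale_def b_def v_def algebra_simps)
    then show "Re (w * exp_martingale z y (down_state s)) = Re (w * exp_martingale z y s) + - (W * (b / v))"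
      by (simp only: W_def minus_complex.sel Re)
    show "c (Suc x) * d (k x) * (W * (b / u)) + c x * d (j x) * (- (W * (b / v))) = 0"
      unfolding u_def[symmetric] v_def[symmetric] using u v by (auto simp: b_def)
  qed
qed

end

section \<open>Urns with divergent inverse weights\<close>

lemma sum_at_top_if_not_summable:
  fixes a :: "nat \<Rightarrow> real"
  assumes nonneg: "\<And>i. 0 \<le> a i" and "\<not> summable a"
  shows "filterlim (\<lambda>k. \<Sum>i<k. a i) at_top sequentially"
  unfolding filterlim_at_top eventually_sequentially
proof
  fix Z :: real
  have "\<exists>n. \<not> (\<Sum>i<n. a i) \<le> Z"
    using summableI_nonneg_bounded[of a Z] assms by blast
  then obtain n where n: "Z < (\<Sum>i<n. a i)" by (auto simp: not_le)
  have "Z \<le> (\<Sum>i<m. a i)" if "n \<le> m" for m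
    using sum_mono2[of "{..<m}" "{..<n}" a] that n nonneg by auto
  then show "\<exists>N. \<forall>n\<ge>N. Z \<le> (\<Sum>i<n. a i)" by blast
qed

lemma prod_at_top_if_not_summable:
  fixes a :: "nat \<Rightarrow> real"
  assumes nonneg: "\<And>i. 0 \<le> a i" and "\<not> summable a"
  shows "filterlim (\<lambda>k. \<Prod>i<k. 1 + a i) at_top sequentially"
proof (rule filterlim_at_top_mono[OF sum_at_top_if_not_summable[OF assms]])
  have "1 + (\<Sum>i<k. a i) \<le> (\<Prod>i<k. 1 + a i)" for k
  proof (induction k)
    case (Suc k)
    have "1 \<le> (\<Prod>i<k. 1 + a i)" by (rule prod_ge_1) (use nonneg in auto)
    then have "a k * 1 \<le> a k * (\<Prod>i<k. 1 + a i)" by (rule mult_left_mono) (rule nonneg)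
    with Suc show ?case by (simp add: algebra_simps)
  qed simp
  then show "\<forall>\<^sub>F k in sequentially. (\<Sum>i<k. a i) \<le> (\<Prod>i<k. 1 + a i)"
    by (intro always_eventually allI) (smt (verit))
qed

context urn_walk
begin

lemma exp_martingale_real:
  "Re (1 * exp_martingale (of_real z) y (x, k, j)) =
    (\<Prod>i<k y. 1 + z / (c (Suc y) * d i)) * (\<Prod>i<j y. 1 - z / (c y * d i))"
proof -
  have "exp_martingale (of_real z) y (x, k, j) = of_real
    ((\<Prod>i<k y. 1 + z / (c (Suc y) * d i)) * (\<Prod>i<j y. 1 - z / (c y * d i)))"
    by (simp add: exp_martingale_def)
  then show ?thesis by (simp only: mult_1 Re_complex_of_real)
qed

lemma exp_martingale_init: "exp_martingale z y (0, (\<lambda>_. 0), (\<lambda>_. 0)) = 1"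
  by (simp add: exp_martingale_def)

text \<open>
  If the up-count at \<open>y\<close> diverged while the down-count stayed bounded, then the product
  martingale with a small positive parameter would tend to infinity, because \<open>\<Sum>i. 1 / d i\<close>
  diverges.
\<close>

lemma inf_ups_imp_inf_downs:
  assumes "0 < y" "\<not> summable (\<lambda>i. 1 / d i)"
  shows "AE \<omega> in M. inf_ups (traj \<omega>) y \<longrightarrow> inf_downs (traj \<omega>) y"
proof -
  (* Half of the smallest down-weight, so that all factors 1 - b i stay positive. *)
  define z where "z = c y * d 0 / 2"
  define a where "a i = z / (c (Suc y) * d i)" for i
  define b where "b i = z / (c y * d i)" for i
  have cy: "0 < c y" "0 < c (Suc y)" and z: "z > 0"
    using c_pos'[OF assms(1)] c_pos d_pos by (auto simp: z_def)
  have a: "0 < a i" for i using z cy d_pos[of i] by (simp add: a_def)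
  have b: "b i \<le> 1 / 2" for i
    using cy d_pos[of i] monoD[OF d_mono, of 0 i] by (simp add: b_def z_def field_simps)
  have Phi: "0 < (\<Prod>i<k. 1 + a i)" for k by (intro prod_pos) (auto simp: add_pos_pos a)
  have Psi: "0 < (\<Prod>i<k. 1 - b i)" for k
  proof (intro prod_pos)
    fix i show "0 < 1 - b i" using b[of i] by linarith
  qed
  have "\<not> summable a"
  proof
    assume "summable a"
    then have "summable (\<lambda>i. a i * (c (Suc y) / z))" by (rule summable_mult2)
    also have "(\<lambda>i. a i * (c (Suc y) / z)) = (\<lambda>i. 1 / d i)" using z cy by (simp add: a_def field_simps)
    finally show False using assms(2) by simp
  qed
  then have lim: "filterlim (\<lambda>k. \<Prod>i<k. 1 + a i) at_top sequentially"
    by (intro prod_at_top_if_not_summable) (auto intro: less_imp_le a)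
  define H where "H s = Re (1 * exp_martingale (of_real z) y s)" for s
  have H: "H (urn_state p n) = (\<Prod>i<ups p n y. 1 + a i) * (\<Prod>i<downs p n y. 1 - b i)"
    if "walk_path p" for p n
    by (simp only: H_def urn_state_eq[OF that] exp_martingale_real a_def b_def)
  have "AE \<omega> in M. \<not> filterlim (\<lambda>n. H (urn_state (traj \<omega>) n)) at_top sequentially"
  proof (rule nonneg_martingale_not_to_infinity)
    show "0 \<le> H (urn_state p n)" if "walk_path p" for p n
      using H[OF that] Phi Psi by (simp add: less_imp_le)
    show "transition H s = H s" for s
      unfolding H_def by (rule transition_exp_martingale[OF assms(1)])
  qed (simp add: H_def exp_martingale_init)
  with AE_walk_path show ?thesis
  proof eventually_elim
    case (elim \<omega>)
    show ?case
    proof (intro impI, rule ccontr)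
      assume *: "inf_ups (traj \<omega>) y" "\<not> inf_downs (traj \<omega>) y"
      obtain J where J: "\<forall>\<^sub>F n in sequentially. downs (traj \<omega>) n y = J"
        using not_inf_downs_eventually_const[OF elim(1) *(2)] by blast
      have "filterlim (\<lambda>n. (\<Prod>i<J. 1 - b i) * (\<Prod>i<ups (traj \<omega>) n y. 1 + a i)) at_top sequentially"
        by (intro filterlim_tendsto_pos_mult_at_top[OF tendsto_const Psi] filterlim_compose[OF lim])
          (use * inf_ups_at_top[OF elim(1)] in simp)
      then have "filterlim (\<lambda>n. H (urn_state (traj \<omega>) n)) at_top sequentially"
        by (rule filterlim_mono_eventually) (use J H[OF elim(1)] in \<open>auto elim: eventually_mono\<close>)
      then show False using elim(2) by simp
    qed
  qed
qed

text \<open>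
  The mirror image, with a small negative parameter.
\<close>

lemma inf_downs_imp_inf_ups:
  assumes "0 < y" "\<not> summable (\<lambda>i. 1 / d i)"
  shows "AE \<omega> in M. inf_downs (traj \<omega>) y \<longrightarrow> inf_ups (traj \<omega>) y"
proof -
  (* Half of the smallest up-weight, so that all factors 1 - a i stay positive. *)
  define z where "z = c (Suc y) * d 0 / 2"
  define a where "a i = z / (c (Suc y) * d i)" for i
  define b where "b i = z / (c y * d i)" for i
  have cy: "0 < c y" "0 < c (Suc y)" and z: "z > 0"
    using c_pos'[OF assms(1)] c_pos d_pos by (auto simp: z_def)
  have b: "0 < b i" for i using z cy d_pos[of i] by (simp add: b_def)
  have a: "a i \<le> 1 / 2" for i
    using cy d_pos[of i] monoD[OF d_mono, of 0 i] by (simp add: a_def z_def field_simps)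
  have Psi: "0 < (\<Prod>i<k. 1 + b i)" for k by (intro prod_pos) (auto simp: add_pos_pos b)
  have Phi: "0 < (\<Prod>i<k. 1 - a i)" for k
  proof (intro prod_pos)
    fix i show "0 < 1 - a i" using a[of i] by linarith
  qed
  have "\<not> summable b"
  proof
    assume "summable b"
    then have "summable (\<lambda>i. b i * (c y / z))" by (rule summable_mult2)
    also have "(\<lambda>i. b i * (c y / z)) = (\<lambda>i. 1 / d i)" using z cy by (simp add: b_def field_simps)
    finally show False using assms(2) by simp
  qed
  then have lim: "filterlim (\<lambda>k. \<Prod>i<k. 1 + b i) at_top sequentially"
    by (intro prod_at_top_if_not_summable) (auto intro: less_imp_le b)
  define H where "H s = Re (1 * exp_martingale (of_real (- z)) y s)" for s
  have H: "H (urn_state p n) = (\<Prod>i<ups p n y. 1 - a i) * (\<Prod>i<downs p n y. 1 + b i)"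
    if "walk_path p" for p n
    by (simp only: H_def urn_state_eq[OF that] exp_martingale_real a_def b_def) simp
  have "AE \<omega> in M. \<not> filterlim (\<lambda>n. H (urn_state (traj \<omega>) n)) at_top sequentially"
  proof (rule nonneg_martingale_not_to_infinity)
    show "0 \<le> H (urn_state p n)" if "walk_path p" for p n
      using H[OF that] Phi Psi by (simp add: less_imp_le)
    show "transition H s = H s" for s
      unfolding H_def by (rule transition_exp_martingale[OF assms(1)])
  qed (simp add: H_def exp_martingale_init)
  with AE_walk_path show ?thesis
  proof eventually_elim
    case (elim \<omega>)
    show ?case
    proof (intro impI, rule ccontr)
      assume *: "inf_downs (traj \<omega>) y" "\<not> inf_ups (traj \<omega>) y"
      obtain J where J: "\<forall>\<^sub>F n in sequentially. ups (traj \<omega>) n y = J"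
        using not_inf_ups_eventually_const[OF elim(1) *(2)] by blast
      have "filterlim (\<lambda>n. (\<Prod>i<J. 1 - a i) * (\<Prod>i<downs (traj \<omega>) n y. 1 + b i)) at_top sequentially"
        by (intro filterlim_tendsto_pos_mult_at_top[OF tendsto_const Phi] filterlim_compose[OF lim])
          (use * inf_downs_at_top[OF elim(1)] in simp)
      then have "filterlim (\<lambda>n. H (urn_state (traj \<omega>) n)) at_top sequentially"
        by (rule filterlim_mono_eventually) (use J H[OF elim(1)] in \<open>auto elim: eventually_mono\<close>)
      then show False using elim(2) by simp
    qed
  qed
qed

theorem AE_recurrent_or_transient:
  assumes "\<not> summable (\<lambda>i. 1 / d i)"
  shows "AE \<omega> in M. if inf_ups (traj \<omega>) 0 then recurrent_path (traj \<omega>) else transient_path (traj \<omega>)"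
proof -
  have "AE \<omega> in M. \<forall>y. 0 < y \<longrightarrow> (inf_ups (traj \<omega>) y \<longleftrightarrow> inf_downs (traj \<omega>) y)"
    unfolding AE_all_countable
  proof
    fix y
    show "AE \<omega> in M. 0 < y \<longrightarrow> (inf_ups (traj \<omega>) y \<longleftrightarrow> inf_downs (traj \<omega>) y)"
    proof (cases "0 < y")
      case True
      show ?thesis
        using inf_ups_imp_inf_downs[OF True assms] inf_downs_imp_inf_ups[OF True assms]
        by eventually_elim blast
    qed simp
  qed
  with AE_walk_path show ?thesis
  proof eventually_elim
    case (elim \<omega>)
    have "infinite {n. X n \<omega> = y} \<longleftrightarrow> inf_ups (traj \<omega>) 0" for y
      using recurrent_or_transient[OF elim(1), of y] elim(2) by blast
    then show ?case by (auto simp: recurrent_path_def transient_path_def)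
  qed
qed

end

section \<open>Fixation of urns with summable inverse weights\<close>

context urn_walk
begin

lemma norm_one_plus_imaginary: "cmod (1 + \<i> * of_real t) = sqrt (1 + t\<^sup>2)"
  by (simp add: cmod_def)

text \<open>
  For an imaginary parameter the modulus of each factor is at least \<open>1\<close>, so the modulus of the
  product is largest in the limit. The third estimate says that stopping at factor \<open>k\<close> loses a
  factor that is at least \<open>\<bar>t k\<bar>\<close>, hence as large as one likes for a large parameter.
\<close>

lemma prod_one_plus_imaginary:
  fixes t :: "nat \<Rightarrow> real"
  assumes "summable (\<lambda>i. \<bar>t i\<bar>)"
  obtains \<phi> where "(\<lambda>k. \<Prod>i<k. 1 + \<i> * of_real (t i)) \<longlonglongrightarrow> \<phi>"
    and "\<And>k. cmod (\<Prod>i<k. 1 + \<i> * of_real (t i)) \<le> cmod \<phi>"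
    and "\<And>k. \<bar>t k\<bar> * cmod (\<Prod>i<k. 1 + \<i> * of_real (t i)) \<le> cmod \<phi>" and "1 \<le> cmod \<phi>"
proof -
  define P where "P k = (\<Prod>i<k. 1 + \<i> * of_real (t i))" for k
  have "abs_convergent_prod (\<lambda>i. 1 + \<i> * of_real (t i))"
    by (rule summable_imp_abs_convergent_prod) (use assms in \<open>simp add: norm_mult\<close>)
  then have "convergent_prod (\<lambda>i. 1 + \<i> * of_real (t i))"
    by (rule abs_convergent_prod_imp_convergent_prod)
  then have "(\<lambda>k. \<Prod>i\<le>k. 1 + \<i> * of_real (t i)) \<longlonglongrightarrow> prodinf (\<lambda>i. 1 + \<i> * of_real (t i))"
    by (rule convergent_prod_LIMSEQ)
  then obtain \<phi> where "(\<lambda>k. P (Suc k)) \<longlonglongrightarrow> \<phi>" by (auto simp: P_def lessThan_Suc_atMost)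
  then have lim: "P \<longlonglongrightarrow> \<phi>" by (rule LIMSEQ_imp_Suc)
  have step: "cmod (P (Suc k)) = cmod (P k) * sqrt (1 + (t k)\<^sup>2)" for k
    by (simp add: P_def norm_mult norm_one_plus_imaginary)
  have inc: "incseq (\<lambda>k. cmod (P k))"
    by (rule incseq_SucI) (simp add: step mult_le_cancel_left1)
  have le: "cmod (P k) \<le> cmod \<phi>" for k
    by (rule incseq_le[OF inc tendsto_norm[OF lim]])
  have "\<bar>t k\<bar> * cmod (P k) \<le> cmod \<phi>" for k
  proof -
    have "\<bar>t k\<bar> \<le> sqrt (1 + (t k)\<^sup>2)" by (rule real_le_rsqrt) simp
    then have "\<bar>t k\<bar> * cmod (P k) \<le> sqrt (1 + (t k)\<^sup>2) * cmod (P k)"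
      by (rule mult_right_mono) simp
    also have "\<dots> = cmod (P (Suc k))" by (simp add: step)
    also have "\<dots> \<le> cmod \<phi>" by (rule le)
    finally show ?thesis .
  qed
  moreover have "1 \<le> cmod \<phi>" using le[of 0] by (simp add: P_def)
  ultimately show thesis using that[of \<phi>] lim le by (simp add: P_def[abs_def])
qed

text \<open>
  Let \<open>E\<close> be the event that both counts diverge, and let \<open>\<Lambda>\<close> be the
  modulus of the limit of the product martingale on \<open>E\<close>, where the parameter is \<open>\<i> *
  \<theta>\<close>. The mean of the martingale is \<open>1\<close>. Off \<open>E\<close>, up to an event of
  small probability, one of the counts stays below a fixed \<open>K\<close>, which makes the martingale at
  most a small multiple of \<open>\<Lambda>\<close> when \<open>\<theta>\<close> is large. So
  \<open>\<Lambda> * prob E\<close> is at most \<open>1\<close> plus a small multiple of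
  \<open>\<Lambda>\<close>, and \<open>\<Lambda>\<close> tends to infinity with \<open>\<theta>\<close>.
\<close>

theorem AE_urn_fixates:
  assumes y: "0 < y" and sum: "summable (\<lambda>i. 1 / d i)"
  shows "AE \<omega> in M. \<not> (inf_ups (traj \<omega>) y \<and> inf_downs (traj \<omega>) y)"
proof -
  have cy: "0 < c y" "0 < c (Suc y)" using c_pos'[OF y] c_pos by auto
  have meas: "{\<omega> \<in> space M. P (ups (traj \<omega>) n y) (downs (traj \<omega>) n y)} \<in> sets M" for n P
    using sets_frozen[of "\<lambda>s. P (fst (snd s) y) (snd (snd s) y)" "\<lambda>_. False" n]
    by (simp add: ups_def downs_def)
  define E where "E = {\<omega> \<in> space M. \<forall>K. (\<exists>n. K \<le> ups (traj \<omega>) n y) \<and> (\<exists>n. K \<le> downs (traj \<omega>) n y)}"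
  define G where "G K = {\<omega> \<in> space M. \<forall>n. ups (traj \<omega>) n y < K \<or> downs (traj \<omega>) n y < K}" for K
  have E [measurable]: "E \<in> sets M" unfolding E_def
    by (intro sets.sets_Collect_countable_All sets.sets_Collect_conj sets.sets_Collect_countable_Ex
        meas[of "\<lambda>a b. K \<le> a" for K] meas[of "\<lambda>a b. K \<le> b" for K])
  have G [measurable]: "G K \<in> sets M" for K unfolding G_def
    by (intro sets.sets_Collect_countable_All meas)
  have "prob E \<le> 0"
  proof (rule field_le_epsilon)
    fix e :: real assume e: "0 < e"
    have "(\<lambda>K. prob (space M - E - G K)) \<longlonglongrightarrow> prob (\<Inter>K. space M - E - G K)"
      by (rule finite_Lim_measure_decseq) (use E G in auto, auto simp: decseq_def G_def dest: less_le_trans)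
    moreover have "(\<Inter>K. space M - E - G K) = {}"
    proof -
      have "\<exists>K. \<omega> \<in> G K" if w: "\<omega> \<in> space M - E" for \<omega>
      proof -
        obtain K where "(\<forall>n. ups (traj \<omega>) n y < K) \<or> (\<forall>n. downs (traj \<omega>) n y < K)"
          using w unfolding E_def Diff_iff mem_Collect_eq not_le[symmetric] by blast
        then show ?thesis using w by (auto simp: G_def)
      qed
      then show ?thesis by blast
    qed
    ultimately have "(\<lambda>K. prob (space M - E - G K)) \<longlonglongrightarrow> 0" by (simp only: measure_empty)
    from order_tendstoD(2)[OF this, of "e / 2"]
    have "\<forall>\<^sub>F K in sequentially. prob (space M - E - G K) < e / 2" using e by simp
    then obtain K where K: "prob (space M - E - G K) < e / 2"
      by (auto simp: eventually_sequentially)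
    (* A bound for the weights whose factors are used: factor K of either product, for the
       configurations in G K, and factor 0, which makes the limit itself large. *)
    define m where "m = c (Suc y) * d 0 + c (Suc y) * d K + c y * d K"
    have m: "m > 0" using cy d_pos by (auto simp: m_def intro!: add_pos_pos)
    define \<theta> where "\<theta> = 4 * m / e"
    have \<theta>: "\<theta> > 0" using m e by (simp add: \<theta>_def)
    define a where "a i = \<theta> / (c (Suc y) * d i)" for i
    define b where "b i = - \<theta> / (c y * d i)" for i
    have "summable (\<lambda>i. \<bar>a i\<bar>)"
      using summable_mult[OF sum, of "\<theta> / c (Suc y)"] \<theta> cy d_pos by (simp add: a_def abs_mult abs_of_pos)
    then obtain \<phi> where \<phi>: "(\<lambda>k. \<Prod>i<k. 1 + \<i> * of_real (a i)) \<longlonglongrightarrow> \<phi>"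
      "\<And>k. cmod (\<Prod>i<k. 1 + \<i> * of_real (a i)) \<le> cmod \<phi>"
      "\<And>k. \<bar>a k\<bar> * cmod (\<Prod>i<k. 1 + \<i> * of_real (a i)) \<le> cmod \<phi>" "1 \<le> cmod \<phi>"
      by (rule prod_one_plus_imaginary) blast
    have "summable (\<lambda>i. \<bar>b i\<bar>)"
      using summable_mult[OF sum, of "\<theta> / c y"] \<theta> cy d_pos by (simp add: b_def abs_mult abs_of_pos)
    then obtain \<psi> where \<psi>: "(\<lambda>k. \<Prod>i<k. 1 + \<i> * of_real (b i)) \<longlonglongrightarrow> \<psi>"
      "\<And>k. cmod (\<Prod>i<k. 1 + \<i> * of_real (b i)) \<le> cmod \<psi>"
      "\<And>k. \<bar>b k\<bar> * cmod (\<Prod>i<k. 1 + \<i> * of_real (b i)) \<le> cmod \<psi>" "1 \<le> cmod \<psi>"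
      by (rule prod_one_plus_imaginary) blast
    define \<Phi> where "\<Phi> k = (\<Prod>i<k. 1 + \<i> * of_real (a i))" for k
    define \<Psi> where "\<Psi> k = (\<Prod>i<k. 1 + \<i> * of_real (b i))" for k
    note \<phi> = \<phi>[folded \<Phi>_def] and \<psi> = \<psi>[folded \<Psi>_def]
    define \<Lambda> where "\<Lambda> = cmod (\<phi> * \<psi>)"
    have \<Lambda>: "\<Lambda> = cmod \<phi> * cmod \<psi>" by (simp add: \<Lambda>_def norm_mult)
    have "0 < cmod \<phi>" "0 < cmod \<psi>" using \<phi>(4) \<psi>(4) by linarith+
    then have \<Lambda>_pos: "\<Lambda> > 0" by (simp add: \<Lambda>)
    (* Rotating by w turns the limit into a positive real number, so real parts suffice. *)
    define w where "w = cnj (\<phi> * \<psi>) / of_real \<Lambda>"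
    have norm_w: "cmod w = 1" using \<open>0 < cmod \<phi>\<close> \<open>0 < cmod \<psi>\<close> by (auto simp: w_def norm_divide norm_mult \<Lambda>)
    have w_eq: "w * (\<phi> * \<psi>) = of_real \<Lambda>"
    proof -
      have "cnj (\<phi> * \<psi>) * (\<phi> * \<psi>) = of_real \<Lambda> * of_real \<Lambda>"
        by (metis \<Lambda>_def complex_norm_square mult.commute power2_eq_square of_real_mult)
      then show ?thesis using \<Lambda>_pos by (simp add: w_def)
    qed
    define H where "H s = Re (w * exp_martingale (\<i> * of_real \<theta>) y s)" for s
    define h where "h n \<omega> = H (frozen (\<lambda>_. False) (traj \<omega>) n)" for n \<omega>
    have h: "h n \<omega> = Re (w * (\<Phi> (ups (traj \<omega>) n y) * \<Psi> (downs (traj \<omega>) n y)))"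
      if "walk_path (traj \<omega>)" for n \<omega>
      by (simp add: h_def H_def urn_state_eq[OF that] exp_martingale_def \<Phi>_def \<Psi>_def a_def b_def)
    have int_h [measurable]: "integrable M (h n)" for n
      unfolding h_def by (rule integrable_frozen)
    have exp_h: "expectation (h n) = Re w" for n
    proof -
      have "stopped_expectation (\<lambda>_. False) n H = H (0, (\<lambda>_. 0), (\<lambda>_. 0))"
        unfolding H_def by (rule stopped_martingale[OF transition_exp_martingale[OF y]])
      moreover have "expectation (h n) = stopped_expectation (\<lambda>_. False) n H"
        by (simp only: stopped_expectation_def h_def[abs_def])
      ultimately show ?thesis by (simp add: H_def exp_martingale_init)
    qed
    have abs_h: "\<bar>h n \<omega>\<bar> \<le> cmod (\<Phi> (ups (traj \<omega>) n y)) * cmod (\<Psi> (downs (traj \<omega>) n y))"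
      if "walk_path (traj \<omega>)" for n \<omega>
      using abs_Re_le_cmod[of "w * (\<Phi> (ups (traj \<omega>) n y) * \<Psi> (downs (traj \<omega>) n y))"]
      by (simp add: h[OF that] norm_mult norm_w)
    have bound: "\<bar>h n \<omega>\<bar> \<le> \<Lambda>" if "walk_path (traj \<omega>)" for n \<omega>
      unfolding \<Lambda> by (rule order_trans[OF abs_h[OF that]]) (intro mult_mono \<phi> \<psi>, auto)
    have mono_\<Phi>: "cmod (\<Phi> k) \<le> cmod (\<Phi> K)" if "k \<le> K" for k
      using that
    proof (induction rule: inc_induct)
      case (step k)
      have "cmod (\<Phi> k) * 1 \<le> cmod (\<Phi> k) * sqrt (1 + (a k)\<^sup>2)" by (intro mult_left_mono) auto
      also have "\<dots> = cmod (\<Phi> (Suc k))" by (simp add: \<Phi>_def norm_mult norm_one_plus_imaginary)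
      finally show ?case using step by simp
    qed simp
    have mono_\<Psi>: "cmod (\<Psi> k) \<le> cmod (\<Psi> K)" if "k \<le> K" for k
      using that
    proof (induction rule: inc_induct)
      case (step k)
      have "cmod (\<Psi> k) * 1 \<le> cmod (\<Psi> k) * sqrt (1 + (b k)\<^sup>2)" by (intro mult_left_mono) auto
      also have "\<dots> = cmod (\<Psi> (Suc k))" by (simp add: \<Psi>_def norm_mult norm_one_plus_imaginary)
      finally show ?case using step by simp
    qed simp
    have am: "\<theta> / m \<le> \<bar>a K\<bar>" "\<theta> / m \<le> \<bar>b K\<bar>" "\<theta> / m \<le> \<bar>a 0\<bar>"
      using \<theta> cy d_pos[of K] d_pos[of 0] m
      by (auto simp: a_def b_def m_def abs_mult intro!: divide_left_mono add_nonneg_nonneg mult_pos_pos)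
    have em: "\<theta> / m = 4 / e" using m by (simp add: \<theta>_def)
    have \<Phi>_K: "cmod (\<Phi> K) \<le> e / 4 * cmod \<phi>" and \<Psi>_K: "cmod (\<Psi> K) \<le> e / 4 * cmod \<psi>"
    proof -
      have "4 / e * cmod (\<Phi> K) \<le> cmod \<phi>"
        by (rule order_trans[OF mult_right_mono \<phi>(3)[of K]]) (use am em in auto)
      then show "cmod (\<Phi> K) \<le> e / 4 * cmod \<phi>" using e by (simp add: field_simps)
      have "4 / e * cmod (\<Psi> K) \<le> cmod \<psi>"
        by (rule order_trans[OF mult_right_mono \<psi>(3)[of K]]) (use am em in auto)
      then show "cmod (\<Psi> K) \<le> e / 4 * cmod \<psi>" using e by (simp add: field_simps)
    qed
    have \<Lambda>_large: "4 / e \<le> \<Lambda>"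
    proof -
      have "4 / e * 1 \<le> cmod \<phi>"
        using order_trans[OF mult_right_mono \<phi>(3)[of 0], of "4 / e"] am em by (simp add: \<Phi>_def)
      also have "\<dots> \<le> cmod \<phi> * cmod \<psi>" using \<psi>(4) by (simp add: mult_le_cancel_left1)
      finally show ?thesis by (simp add: \<Lambda>)
    qed
    have bound_G: "\<bar>h n \<omega>\<bar> \<le> e / 4 * \<Lambda>" if "walk_path (traj \<omega>)" "\<omega> \<in> G K" for n \<omega>
    proof (cases "ups (traj \<omega>) n y < K")
      case True
      have "\<bar>h n \<omega>\<bar> \<le> (e / 4 * cmod \<phi>) * cmod \<psi>"
        by (rule order_trans[OF abs_h[OF that(1)]])
          (intro mult_mono order_trans[OF mono_\<Phi> \<Phi>_K] \<psi>, use True e in auto)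
      then show ?thesis by (simp add: \<Lambda>)
    next
      case False
      then have "downs (traj \<omega>) n y < K" using that(2) by (auto simp: G_def)
      then have "\<bar>h n \<omega>\<bar> \<le> cmod \<phi> * (e / 4 * cmod \<psi>)"
        by (intro order_trans[OF abs_h[OF that(1)]] mult_mono order_trans[OF mono_\<Psi> \<Psi>_K] \<phi>) auto
      then show ?thesis by (simp add: \<Lambda> mult.left_commute)
    qed
    have int_Eh: "integrable M (\<lambda>\<omega>. indicator E \<omega> * h n \<omega>)" for n
      using integrable_real_mult_indicator[OF E int_h[of n]] by (simp add: mult.commute)
    have D: "space M - E - G K \<in> sets M" using E G by auto
    have int_ind: "integrable M (indicator (space M - E - G K) :: _ \<Rightarrow> real)"
      by (rule integrable_real_indicator[OF D]) (simp add: emeasure_eq_measure)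
    have lower: "expectation (\<lambda>\<omega>. indicator E \<omega> * h n \<omega>) \<le> 1 + \<Lambda> * (e / 2) + e / 4 * \<Lambda>" for n
    proof -
      have "expectation (\<lambda>\<omega>. indicator E \<omega> * h n \<omega>) - expectation (h n) =
          expectation (\<lambda>\<omega>. indicator E \<omega> * h n \<omega> - h n \<omega>)"
        by (rule Bochner_Integration.integral_diff[symmetric, OF int_Eh int_h])
      also have "\<dots> \<le> expectation (\<lambda>\<omega>. \<Lambda> * indicator (space M - E - G K) \<omega> + e / 4 * \<Lambda>)"
      proof (rule integral_mono_AE)
        show "AE \<omega> in M. indicator E \<omega> * h n \<omega> - h n \<omega> \<le>
            \<Lambda> * indicator (space M - E - G K) \<omega> + e / 4 * \<Lambda>"
          using AE_walk_path AE_space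
        proof eventually_elim
          case (elim \<omega>)
          show ?case
            using bound[OF elim(1), of n] bound_G[OF elim(1), of n] elim(2) \<Lambda>_pos mult_pos_pos[OF e \<Lambda>_pos]
            by (auto simp: indicator_def)
        qed
      qed (use int_Eh int_h int_ind in auto)
      also have "\<dots> = \<Lambda> * prob (space M - E - G K) + e / 4 * \<Lambda>"
        using int_ind D by (simp add: prob_space Int_absorb1)
      also have "\<dots> \<le> \<Lambda> * (e / 2) + e / 4 * \<Lambda>" using K \<Lambda>_pos by simp
      finally have "expectation (\<lambda>\<omega>. indicator E \<omega> * h n \<omega>) - expectation (h n) \<le>
          \<Lambda> * (e / 2) + e / 4 * \<Lambda>" .
      moreover have "expectation (h n) \<le> 1"
        using complex_Re_le_cmod[of w] by (simp add: exp_h norm_w)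
      ultimately show ?thesis by linarith
    qed
    have "(\<lambda>n. expectation (\<lambda>\<omega>. indicator E \<omega> * h n \<omega>)) \<longlonglongrightarrow> expectation (\<lambda>\<omega>. indicator E \<omega> * \<Lambda>)"
    proof (rule integral_dominated_convergence[where w = "\<lambda>_. \<Lambda>"])
      show "AE \<omega> in M. (\<lambda>n. indicator E \<omega> * h n \<omega>) \<longlonglongrightarrow> indicator E \<omega> * \<Lambda>"
        using AE_walk_path
      proof eventually_elim
        case (elim \<omega>)
        show ?case
        proof (cases "\<omega> \<in> E")
          case True
          then have "inf_ups (traj \<omega>) y" "inf_downs (traj \<omega>) y"
            by (auto simp: E_def inf_ups_def inf_downs_def)
          then have "filterlim (\<lambda>n. ups (traj \<omega>) n y) at_top sequentially"
            "filterlim (\<lambda>n. downs (traj \<omega>) n y) at_top sequentially"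
            using inf_ups_at_top[OF elim] inf_downs_at_top[OF elim] by auto
          then have "(\<lambda>n. w * (\<Phi> (ups (traj \<omega>) n y) * \<Psi> (downs (traj \<omega>) n y))) \<longlonglongrightarrow> w * (\<phi> * \<psi>)"
            by (intro tendsto_intros filterlim_compose[OF \<phi>(1)] filterlim_compose[OF \<psi>(1)])
          from tendsto_Re[OF this] have "(\<lambda>n. h n \<omega>) \<longlonglongrightarrow> \<Lambda>"
            unfolding w_eq h[OF elim] by simp
          then show ?thesis by (intro tendsto_mult tendsto_const)
        qed simp
      qed
      show "AE \<omega> in M. norm (indicator E \<omega> * h n \<omega>) \<le> \<Lambda>" for n
        using AE_walk_path by eventually_elim (use bound \<Lambda>_pos in \<open>auto simp: indicator_def\<close>)
    qed (use borel_measurable_integrable[OF int_Eh] E in auto)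
    then have "expectation (\<lambda>\<omega>. indicator E \<omega> * \<Lambda>) \<le> 1 + \<Lambda> * (e / 2) + e / 4 * \<Lambda>"
      by (rule LIMSEQ_le_const2) (use lower in auto)
    then have "prob E * \<Lambda> \<le> 1 + \<Lambda> * (e / 2) + e / 4 * \<Lambda>" using E by simp
    moreover have "1 \<le> e / 4 * \<Lambda>" using \<Lambda>_large e by (simp add: field_simps)
    ultimately have "prob E * \<Lambda> \<le> e * \<Lambda>" by (simp add: field_simps)
    then show "prob E \<le> 0 + e" using \<Lambda>_pos by simp
  qed
  then have "AE \<omega> in M. \<omega> \<notin> E"
    using E by (intro AE_not_in) (auto simp: null_sets_def emeasure_eq_measure measure_le_0_iff)
  with AE_space show ?thesis
    by eventually_elim (auto simp: E_def inf_ups_def inf_downs_def)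
qed

end

section \<open>Transience\<close>

context urn_walk
begin

lemma inv_sum_nonneg: "0 \<le> inv_sum k"
  unfolding inv_sum_def by (intro sum_nonneg) (simp add: d_pos less_imp_le)

lemma inv_sum_mono: "k \<le> l \<Longrightarrow> inv_sum k \<le> inv_sum l"
  unfolding inv_sum_def by (intro sum_mono2) (auto simp: d_pos less_imp_le)

lemma inv_sum_0 [simp]: "inv_sum 0 = 0"
  by (simp add: inv_sum_def)

lemma inv_sum_Suc: "inv_sum (Suc k) = inv_sum k + 1 / d k"
  by (simp add: inv_sum_def)

text \<open>
  The stopping rule for the \<open>m\<close>-th return to \<open>0\<close>. Until then at most
  \<open>m\<close> departures from \<open>0\<close> have occurred.
\<close>

definition returned :: "nat \<Rightarrow> urn_config \<Rightarrow> bool" where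
  "returned m = (\<lambda>(x, k, j). x = 0 \<and> m \<le> k 0)"

abbreviation up_count :: "nat \<Rightarrow> urn_config \<Rightarrow> nat" where
  "up_count y s \<equiv> fst (snd s) y"

abbreviation down_count :: "nat \<Rightarrow> urn_config \<Rightarrow> nat" where
  "down_count y s \<equiv> snd (snd s) y"

lemma returned_iff: "returned m s \<longleftrightarrow> fst s = 0 \<and> m \<le> up_count 0 s"
  by (cases s) (simp add: returned_def)

lemma up_count_0_frozen:
  assumes p: "walk_path p"
  shows "up_count 0 (frozen (returned m) p n) \<le> m"
proof (induction n)
  case (Suc n)
  show ?case
  proof (cases "returned m (frozen (returned m) p n)")
    case False
    then have eq: "frozen (returned m) p n = urn_state p n" by (rule frozen_unstopped)
    then have "p n = 0 \<longrightarrow> ups p n 0 < m"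
      using False by (auto simp: returned_def urn_state_eq[OF p])
    moreover have "ups p n 0 \<le> m" using Suc eq by (simp add: urn_state_eq[OF p])
    ultimately show ?thesis
      using False by (auto simp: ups_def[symmetric] ups_Suc[OF p] simp del: urn_state.simps(2))
  qed (use Suc in simp)
qed simp

lemma consistent_count:
  assumes "walk_path p"
  shows "up_count y (frozen B p n) = down_count (Suc y) (frozen B p n) + of_bool (y < fst (frozen B p n))"
  using consistent_frozen[OF assms, of B n] by (auto simp: consistent_def split: prod.splits)

lemma up_count_frozen_eq_0:
  assumes "walk_path p" "n \<le> y"
  shows "up_count y (frozen B p n) = 0"
proof -
  obtain i where "i \<le> n" "frozen B p n = urn_state p i" using frozen_reached[of n B p] by blast
  then show ?thesis using ups_eq_0[OF assms(1), of i y] assms(2) by (simp add: urn_state_eq[OF assms(1)])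
qed

text \<open>
  The gaps have mean \<open>0\<close>, and the walk leaves \<open>y + 1\<close> downwards at most as often
  as it leaves \<open>y\<close> upwards. So the mean of \<open>inv_sum (up_count y) / c (y + 1)\<close> does
  not increase with \<open>y\<close>.
\<close>

lemma expectation_inv_sum:
  fixes m n
  defines "f \<equiv> inv_sum m / c 1"
  shows "stopped_expectation (returned m) n (\<lambda>s. inv_sum (up_count y s)) \<le> c (Suc y) * f"
    and "stopped_expectation (returned m) n (\<lambda>s. inv_sum (down_count (Suc y) s)) \<le> c (Suc y) * f"
proof -
  let ?E = "stopped_expectation (returned m) n"
  have down: "?E (\<lambda>s. inv_sum (down_count (Suc y) s)) \<le> ?E (\<lambda>s. inv_sum (up_count y s))" for y
    by (rule stopped_expectation_mono) (auto simp: consistent_count intro!: inv_sum_mono)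
  show up: "?E (\<lambda>s. inv_sum (up_count y s)) \<le> c (Suc y) * f" for y
  proof (induction y)
    case 0
    have "?E (\<lambda>s. inv_sum (up_count 0 s)) \<le> ?E (\<lambda>_. inv_sum m)"
      by (rule stopped_expectation_mono) (intro inv_sum_mono up_count_0_frozen)
    then show ?case using c_pos[of 0] by (simp add: f_def)
  next
    case (Suc y)
    have "?E (\<lambda>s. inv_sum (up_count (Suc y) s) / c (Suc (Suc y)) - inv_sum (down_count (Suc y) s) / c (Suc y)) = 0"
      using expectation_urn_gap[of "Suc y" "returned m" n] by (simp add: urn_gap_def split_def)
    then have "?E (\<lambda>s. inv_sum (up_count (Suc y) s)) / c (Suc (Suc y)) =
        ?E (\<lambda>s. inv_sum (down_count (Suc y) s)) / c (Suc y)"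
      by (simp only: stopped_expectation_diff stopped_expectation_divide right_minus_eq)
    also have "\<dots> \<le> (c (Suc y) * f) / c (Suc y)"
      using order_trans[OF down Suc] c_pos[of y] by (intro divide_right_mono) auto
    also have "\<dots> = f" using c_pos[of y] by simp
    finally show ?case using c_pos[of "Suc y"] by (simp add: field_simps)
  qed
  show "?E (\<lambda>s. inv_sum (down_count (Suc y) s)) \<le> c (Suc y) * f"
    using down up by (rule order_trans)
qed

text \<open>
  This linear bound replaces Jensen's inequality for \<open>\<lambda>F. F powr \<gamma>\<close>; taking a
  bound on the mean of \<open>F\<close> for \<open>l\<close> loses only a factor \<open>2\<close>.
\<close>

lemma powr_le_linear:
  fixes F l \<gamma> :: real
  assumes "0 \<le> F" "0 < l" "0 \<le> \<gamma>" "\<gamma> \<le> 1"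
  shows "F powr \<gamma> \<le> l powr \<gamma> + l powr (\<gamma> - 1) * F"
proof (cases "F \<le> l")
  case True
  then have "F powr \<gamma> \<le> l powr \<gamma>" using assms by (intro powr_mono2) auto
  moreover have "0 \<le> l powr (\<gamma> - 1) * F" using assms by simp
  ultimately show ?thesis by linarith
next
  case False
  then have "F > 0" using assms by linarith
  then have "F powr \<gamma> = F powr (\<gamma> - 1) * F" by (simp add: powr_diff)
  also have "\<dots> \<le> l powr (\<gamma> - 1) * F"
    using False assms by (intro mult_right_mono powr_mono2') auto
  finally show ?thesis using assms by (simp add: add_increasing)
qed

text \<open>
  Chebyshev's inequality for the sum of the gaps, which equals \<open>- f\<close> on the event in question.
\<close>

lemma returned_rarely:
  assumes \<gamma>: "0 \<le> \<gamma>" "\<gamma> \<le> 1" and "0 \<le> C"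
    and sq: "\<And>k. inv_sq_sum k \<le> C * inv_sum k powr \<gamma>"
    and sum: "summable (\<lambda>y. c (Suc y) powr (\<gamma> - 2))"
    and m: "0 < m"
  defines "f \<equiv> inv_sum m / c 1"
  shows "prob {\<omega> \<in> space M. returned m (frozen (returned m) (traj \<omega>) n)} \<le>
    4 * C * (\<Sum>y. c (Suc y) powr (\<gamma> - 2)) * f powr (\<gamma> - 2)"
proof -
  let ?E = "stopped_expectation (returned m) n"
  define T where "T = (\<Sum>y. c (Suc y) powr (\<gamma> - 2))"
  have f: "f > 0"
  proof -
    have "0 < 1 / d 0" using d_pos by simp
    also have "\<dots> \<le> inv_sum m" using inv_sum_mono[of 1 m] m by (simp add: inv_sum_def)
    finally show ?thesis using c_pos[of 0] by (simp add: f_def)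
  qed
  have sq_bound: "?E (\<lambda>s. inv_sq_sum (N s)) / (c (Suc y))\<^sup>2 \<le> 2 * C * f powr \<gamma> * c (Suc y) powr (\<gamma> - 2)"
    if N: "?E (\<lambda>s. inv_sum (N s)) \<le> c (Suc y) * f" for N y
  proof -
    define l where "l = c (Suc y) * f"
    have l: "l > 0" using f c_pos by (simp add: l_def)
    have "?E (\<lambda>s. inv_sq_sum (N s)) \<le> ?E (\<lambda>s. C * (l powr \<gamma> + l powr (\<gamma> - 1) * inv_sum (N s)))"
      by (rule stopped_expectation_mono)
        (intro order_trans[OF sq] mult_left_mono powr_le_linear inv_sum_nonneg l \<gamma> \<open>0 \<le> C\<close>)
    also have "\<dots> = C * (l powr \<gamma> + l powr (\<gamma> - 1) * ?E (\<lambda>s. inv_sum (N s)))"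
      by (simp only: stopped_expectation_cmult stopped_expectation_add stopped_expectation_const)
    also have "\<dots> \<le> C * (l powr \<gamma> + l powr (\<gamma> - 1) * l)"
      using N \<open>0 \<le> C\<close> by (intro mult_left_mono add_left_mono) (auto simp: l_def)
    also have "\<dots> = 2 * C * l powr \<gamma>" using l by (simp add: powr_diff)
    finally have "?E (\<lambda>s. inv_sq_sum (N s)) / (c (Suc y))\<^sup>2 \<le> 2 * C * l powr \<gamma> / (c (Suc y))\<^sup>2"
      by (rule divide_right_mono) simp
    also have "\<dots> = 2 * C * f powr \<gamma> * c (Suc y) powr (\<gamma> - 2)"
      using c_pos[of y] f by (simp add: l_def powr_mult powr_diff)
    finally show ?thesis .
  qed
  have "f\<^sup>2 * prob {\<omega> \<in> space M. returned m (frozen (returned m) (traj \<omega>) n)} =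
      ?E (\<lambda>s. f\<^sup>2 * of_bool (returned m s))"
    by (simp add: stopped_expectation_cmult stopped_expectation_of_bool)
  also have "\<dots> \<le> ?E (\<lambda>s. (\<Sum>y\<in>{1..n}. urn_gap y s)\<^sup>2)"
  proof (rule stopped_expectation_mono)
    fix p assume p: "walk_path p"
    let ?s = "frozen (returned m) p n"
    show "f\<^sup>2 * of_bool (returned m ?s) \<le> (\<Sum>y\<in>{1..n}. urn_gap y ?s)\<^sup>2"
    proof (cases "returned m ?s")
      case True
      then have x: "fst ?s = 0" and "m \<le> up_count 0 ?s" by (auto simp: returned_iff)
      then have m_eq: "up_count 0 ?s = m" using up_count_0_frozen[OF p, where m = m and n = n] by simp
      have "(\<Sum>y\<in>{1..n}. urn_gap y ?s) = (\<Sum>y<n. urn_gap (Suc y) ?s)"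
        by (rule sum.reindex_bij_witness[of _ Suc "\<lambda>y. y - 1"]) auto
      also have "\<dots> = (\<Sum>y<n. inv_sum (up_count (Suc y) ?s) / c (Suc (Suc y)) - inv_sum (up_count y ?s) / c (Suc y))"
        using consistent_count[OF p, where B = "returned m" and n = n] x by (simp add: urn_gap_def split_def)
      also have "\<dots> = inv_sum (up_count n ?s) / c (Suc n) - inv_sum (up_count 0 ?s) / c 1"
        using sum_lessThan_telescope[of "\<lambda>y. inv_sum (up_count y ?s) / c (Suc y)" n] by simp
      also have "\<dots> = - f" using up_count_frozen_eq_0[OF p order_refl] m_eq by (simp add: f_def)
      finally show ?thesis by simp
    qed simp
  qed
  also have "\<dots> = (\<Sum>y\<in>{1..n}. ?E (urn_gap_var y))" by (rule expectation_gap_square)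
  also have "\<dots> \<le> (\<Sum>y<n. 2 * C * f powr \<gamma> * (c (Suc (Suc y)) powr (\<gamma> - 2) + c (Suc y) powr (\<gamma> - 2)))"
  proof -
    have "?E (urn_gap_var (Suc y)) \<le> 2 * C * f powr \<gamma> * (c (Suc (Suc y)) powr (\<gamma> - 2) + c (Suc y) powr (\<gamma> - 2))" for y
    proof -
      have "?E (urn_gap_var (Suc y)) = ?E (\<lambda>s. inv_sq_sum (up_count (Suc y) s)) / (c (Suc (Suc y)))\<^sup>2 +
          ?E (\<lambda>s. inv_sq_sum (down_count (Suc y) s)) / (c (Suc y))\<^sup>2"
        unfolding stopped_expectation_divide[symmetric] stopped_expectation_add[symmetric]
        by (simp add: urn_gap_var_def split_def)
      also have "\<dots> \<le> 2 * C * f powr \<gamma> * c (Suc (Suc y)) powr (\<gamma> - 2) + 2 * C * f powr \<gamma> * c (Suc y) powr (\<gamma> - 2)"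
        unfolding f_def by (intro add_mono sq_bound[unfolded f_def] expectation_inv_sum)
      finally show ?thesis by (simp add: algebra_simps)
    qed
    moreover have "(\<Sum>y\<in>{1..n}. ?E (urn_gap_var y)) = (\<Sum>y<n. ?E (urn_gap_var (Suc y)))"
      by (rule sum.reindex_bij_witness[of _ Suc "\<lambda>y. y - 1"]) auto
    ultimately show ?thesis by (simp add: sum_mono)
  qed
  also have "\<dots> = 2 * C * f powr \<gamma> *
      ((\<Sum>y<n. c (Suc (Suc y)) powr (\<gamma> - 2)) + (\<Sum>y<n. c (Suc y) powr (\<gamma> - 2)))"
    by (simp add: sum_distrib_left[symmetric] sum.distrib)
  also have "\<dots> \<le> 2 * C * f powr \<gamma> * (T + T)"
  proof (intro mult_left_mono add_mono)
    have "(\<Sum>y<n. c (Suc (Suc y)) powr (\<gamma> - 2)) \<le> (\<Sum>y<Suc n. c (Suc y) powr (\<gamma> - 2))"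
      by (simp add: sum.lessThan_Suc_shift del: sum.lessThan_Suc)
    also have "\<dots> \<le> T" unfolding T_def by (rule sum_le_suminf[OF sum]) auto
    finally show "(\<Sum>y<n. c (Suc (Suc y)) powr (\<gamma> - 2)) \<le> T" .
    show "(\<Sum>y<n. c (Suc y) powr (\<gamma> - 2)) \<le> T" unfolding T_def by (rule sum_le_suminf[OF sum]) auto
  qed (use \<open>0 \<le> C\<close> in auto)
  also have "\<dots> = f\<^sup>2 * (4 * C * T * f powr (\<gamma> - 2))"
    using f by (simp add: powr_diff)
  finally show ?thesis using f by (simp add: T_def)
qed

lemma eventually_returned:
  assumes p: "walk_path p" and "inf_ups p 0"
  shows "\<forall>\<^sub>F n in sequentially. returned m (frozen (returned m) p n)"
proof -
  obtain n0 where n0: "m \<le> ups p n0 0" using assms(2) by (auto simp: inf_ups_def)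
  have "infinite {n. p n = 0}" using infinite_visits_iff[OF p] assms(2) by blast
  then obtain i where i: "n0 \<le> i" "p i = 0" unfolding infinite_nat_iff_unbounded_le by blast
  then have "returned m (urn_state p i)"
    using order_trans[OF n0 ups_mono[OF p i(1)]] by (simp add: returned_def urn_state_eq[OF p])
  then show ?thesis unfolding eventually_sequentially using frozen_stopped[of "returned m"] by blast
qed

text \<open>
  The bound for the \<open>m\<close>-th return tends to \<open>0\<close> because \<open>\<gamma> < 2\<close>
  and \<open>inv_sum m\<close> tends to infinity.
\<close>

theorem AE_transient:
  assumes \<gamma>: "0 \<le> \<gamma>" "\<gamma> \<le> 1" and C: "0 \<le> C"
    and sq: "\<And>k. inv_sq_sum k \<le> C * inv_sum k powr \<gamma>"
    and sum: "summable (\<lambda>y. c (Suc y) powr (\<gamma> - 2))"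
    and div: "\<not> summable (\<lambda>i. 1 / d i)"
  shows "AE \<omega> in M. transient_path (traj \<omega>)"
proof -
  have "filterlim inv_sum at_top sequentially"
    unfolding inv_sum_def[abs_def]
    by (rule sum_at_top_if_not_summable) (use d_pos div in \<open>auto simp: less_imp_le\<close>)
  then have "filterlim (\<lambda>m. (1 / c 1) * inv_sum m) at_top sequentially"
    using c_pos[of 0] by (intro filterlim_tendsto_pos_mult_at_top[OF tendsto_const]) auto
  then have "filterlim (\<lambda>m. inv_sum m / c 1) at_top sequentially" by simp
  then have "(\<lambda>m. (inv_sum m / c 1) powr (\<gamma> - 2)) \<longlonglongrightarrow> 0"
    by (intro tendsto_neg_powr) (use \<gamma> in auto)
  then have "(\<lambda>m. 4 * C * (\<Sum>y. c (Suc y) powr (\<gamma> - 2)) * (inv_sum m / c 1) powr (\<gamma> - 2)) \<longlonglongrightarrow> 0"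
    by (rule tendsto_mult_right_zero)
  note ev = order_tendstoD(2)[OF this]
  have "\<exists>m. \<forall>n. prob {\<omega> \<in> space M. returned m (frozen (returned m) (traj \<omega>) n)} \<le> \<epsilon>" if pos: "\<epsilon> > 0" for \<epsilon>
  proof -
    obtain m where "0 < m" "4 * C * (\<Sum>y. c (Suc y) powr (\<gamma> - 2)) * (inv_sum m / c 1) powr (\<gamma> - 2) < \<epsilon>"
      using eventually_happens[OF eventually_conj[OF ev[OF pos] eventually_gt_at_top[of 0]]] by auto
    then show ?thesis using returned_rarely[OF \<gamma> C sq sum, of m] by (meson less_imp_le order_trans)
  qed
  then obtain m where m: "\<And>\<epsilon> n. \<epsilon> > 0 \<Longrightarrow>
      prob {\<omega> \<in> space M. returned (m \<epsilon>) (frozen (returned (m \<epsilon>)) (traj \<omega>) n)} \<le> \<epsilon>"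
    by metis
  have "AE \<omega> in M. \<not> inf_ups (traj \<omega>) 0"
  proof (rule AE_not_if_rarely[where A = "\<lambda>\<epsilon> n. {\<omega> \<in> space M. returned (m \<epsilon>) (frozen (returned (m \<epsilon>)) (traj \<omega>) n)}"])
    show "AE \<omega> in M. \<forall>\<epsilon>>0. inf_ups (traj \<omega>) 0 \<longrightarrow> (\<forall>\<^sub>F n in sequentially. \<omega> \<in>
        {\<omega> \<in> space M. returned (m \<epsilon>) (frozen (returned (m \<epsilon>)) (traj \<omega>) n)})"
      using AE_walk_path AE_space by eventually_elim (auto intro: eventually_returned)
  qed (use m sets_frozen in auto)
  with AE_recurrent_or_transient[OF div] show ?thesis
    by eventually_elim simp
qed

end

section \<open>Recurrence\<close>

context urn_walk
begin

text \<open>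
  The sum of the gaps below \<open>L\<close> telescopes to a difference of scaled values of
  \<open>inv_sum\<close> plus the resistance \<open>cost\<close> of the edges below both the walk and
  \<open>L\<close>, so the mean of \<open>cost\<close> is at most \<open>f\<close>. If the walk is at height
  \<open>L\<close> or above, each \<open>y < L\<close> contributes at least \<open>\<epsilon> * r y\<close>,
  either to \<open>cost\<close> or, when the edge above \<open>y\<close> has been crossed unusually often,
  to a sum whose mean is small for large \<open>K\<close>.
\<close>

lemma high_unreturned_rarely:
  fixes m n L :: nat
  assumes r: "\<And>y. 0 \<le> r y" and "0 < K" "0 < \<epsilon>"
    and lower: "\<And>y k. inv_sum (Suc k) \<le> K * c (Suc y) \<Longrightarrow> \<epsilon> * r y \<le> 1 / (c (Suc y) * d k)"
  defines "f \<equiv> inv_sum m / c 1"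
  shows "\<epsilon> * (\<Sum>y<L. r y) * prob {\<omega> \<in> space M. L \<le> fst (frozen (returned m) (traj \<omega>) n)} \<le>
    f + \<epsilon> / K * (\<Sum>y<L. r y) * f"
proof -
  let ?E = "stopped_expectation (returned m) n"
  define R where "R = (\<Sum>y<L. r y)"
  define cost where "cost s = (\<Sum>y<L. of_bool (y < fst s) / (c (Suc y) * d (up_count y s - 1)))" for s :: urn_config
  have "?E cost \<le> f"
  proof -
    have "?E cost = ?E (\<lambda>s. inv_sum (up_count 0 s) / c 1 - inv_sum (up_count L s) / c (Suc L) +
        (\<Sum>y<L. urn_gap (Suc y) s))"
    proof (rule stopped_expectation_cong)
      fix p assume p: "walk_path p"
      let ?s = "frozen (returned m) p n"
      have "urn_gap (Suc y) ?s = (inv_sum (up_count (Suc y) ?s) / c (Suc (Suc y)) - inv_sum (up_count y ?s) / c (Suc y))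
          + of_bool (y < fst ?s) / (c (Suc y) * d (up_count y ?s - 1))" for y
        using consistent_count[OF p, where y = y and B = "returned m" and n = n]
        by (auto simp: urn_gap_def split_def inv_sum_Suc diff_divide_distrib add_divide_distrib)
      then have "(\<Sum>y<L. urn_gap (Suc y) ?s) =
          (inv_sum (up_count L ?s) / c (Suc L) - inv_sum (up_count 0 ?s) / c (Suc 0)) + cost ?s"
        using sum_lessThan_telescope[of "\<lambda>y. inv_sum (up_count y ?s) / c (Suc y)" L]
        by (simp only: sum.distrib cost_def)
      then show "cost ?s = inv_sum (up_count 0 ?s) / c 1 - inv_sum (up_count L ?s) / c (Suc L) +
        (\<Sum>y<L. urn_gap (Suc y) ?s)" by simp
    qed
    also have "\<dots> = ?E (\<lambda>s. inv_sum (up_count 0 s) / c 1 - inv_sum (up_count L s) / c (Suc L))"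
      by (simp add: stopped_expectation_add stopped_expectation_sum expectation_urn_gap)
    also have "\<dots> \<le> ?E (\<lambda>s. f)"
    proof (rule stopped_expectation_mono)
      fix p assume p: "walk_path p"
      let ?s = "frozen (returned m) p n"
      have "inv_sum (up_count 0 ?s) / c 1 \<le> f" unfolding f_def
        by (intro divide_right_mono inv_sum_mono up_count_0_frozen p c_nonneg)
      moreover have "0 \<le> inv_sum (up_count L ?s) / c (Suc L)" by (simp add: inv_sum_nonneg c_nonneg)
      ultimately show "inv_sum (up_count 0 ?s) / c 1 - inv_sum (up_count L ?s) / c (Suc L) \<le> f" by linarith
    qed
    finally show ?thesis by simp
  qed
  have "\<epsilon> * R * prob {\<omega> \<in> space M. L \<le> fst (frozen (returned m) (traj \<omega>) n)} =
      ?E (\<lambda>s. \<epsilon> * R * of_bool (L \<le> fst s))"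
    by (simp add: stopped_expectation_cmult stopped_expectation_of_bool)
  also have "\<dots> \<le> ?E (\<lambda>s. cost s + (\<Sum>y<L. \<epsilon> / K * r y * (inv_sum (up_count y s) / c (Suc y))))"
  proof (rule stopped_expectation_mono)
    fix p assume p: "walk_path p"
    let ?s = "frozen (returned m) p n"
    have nn: "0 \<le> \<epsilon> / K * r y * (inv_sum (up_count y ?s) / c (Suc y))"
      "0 \<le> of_bool (y < fst ?s) / (c (Suc y) * d (up_count y ?s - 1))" for y
      using \<open>0 < K\<close> \<open>0 < \<epsilon>\<close> r inv_sum_nonneg c_nonneg d_pos[of "up_count y ?s - 1"] by (auto intro!: mult_nonneg_nonneg divide_nonneg_nonneg)
    show "\<epsilon> * R * of_bool (L \<le> fst ?s) \<le>
        cost ?s + (\<Sum>y<L. \<epsilon> / K * r y * (inv_sum (up_count y ?s) / c (Suc y)))"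
    proof (cases "L \<le> fst ?s")
      case True
      have "(\<Sum>y<L. \<epsilon> * r y) \<le> (\<Sum>y<L. of_bool (y < fst ?s) / (c (Suc y) * d (up_count y ?s - 1)) +
          \<epsilon> / K * r y * (inv_sum (up_count y ?s) / c (Suc y)))"
      proof (rule sum_mono)
        fix y assume "y \<in> {..<L}"
        then have y: "y < fst ?s" using True by simp
        then obtain k where k: "up_count y ?s = Suc k"
          using consistent_count[OF p, where y = y and B = "returned m" and n = n] by simp
        show "\<epsilon> * r y \<le> of_bool (y < fst ?s) / (c (Suc y) * d (up_count y ?s - 1)) +
          \<epsilon> / K * r y * (inv_sum (up_count y ?s) / c (Suc y))"
        proof (cases "inv_sum (Suc k) \<le> K * c (Suc y)")
          case True
          then show ?thesis using lower[OF True] nn(1)[of y] y k by simp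
        next
          case False
          then have "K \<le> inv_sum (up_count y ?s) / c (Suc y)" using c_pos[of y] k by (simp add: field_simps)
          then have "\<epsilon> / K * r y * K \<le> \<epsilon> / K * r y * (inv_sum (up_count y ?s) / c (Suc y))"
            using \<open>0 < K\<close> \<open>0 < \<epsilon>\<close> r by (intro mult_left_mono) auto
          then show ?thesis using nn(2)[of y] \<open>0 < K\<close> by simp
        qed
      qed
      then show ?thesis using True by (simp add: cost_def R_def sum.distrib sum_distrib_left)
    next
      case False
      have "0 \<le> cost ?s" unfolding cost_def by (intro sum_nonneg nn)
      moreover have "0 \<le> (\<Sum>y<L. \<epsilon> / K * r y * (inv_sum (up_count y ?s) / c (Suc y)))"
        by (intro sum_nonneg nn)
      ultimately show ?thesis using False by simp
    qed
  qed
  also have "\<dots> = ?E cost + (\<Sum>y<L. \<epsilon> / K * r y * (?E (\<lambda>s. inv_sum (up_count y s)) / c (Suc y)))"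
    by (simp only: stopped_expectation_add stopped_expectation_sum stopped_expectation_cmult stopped_expectation_divide)
  also have "\<dots> \<le> f + (\<Sum>y<L. \<epsilon> / K * r y * f)"
  proof (intro add_mono sum_mono mult_left_mono)
    fix y
    show "?E (\<lambda>s. inv_sum (up_count y s)) / c (Suc y) \<le> f"
      using expectation_inv_sum(1)[of m n y] c_pos[of y] by (simp add: f_def field_simps)
    show "0 \<le> \<epsilon> / K * r y" using \<open>0 < K\<close> \<open>0 < \<epsilon>\<close> r by simp
  qed fact
  also have "(\<Sum>y<L. \<epsilon> / K * r y * f) = \<epsilon> / K * R * f"
    by (simp add: R_def sum_distrib_left sum_distrib_right mult.assoc)
  finally show ?thesis by (simp add: R_def)
qed

text \<open>
  The hypothesis \<open>lower\<close> says that edges with typical crossing numbers have resistance of the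
  order of \<open>r\<close>, the terms of a divergent series. On a transient path with fewer than
  \<open>m\<close> departures from \<open>0\<close>, the stopped walk stays above any height from some time
  on.
\<close>

theorem AE_recurrent:
  assumes r: "\<And>y. 0 \<le> r y" "\<not> summable r"
    and lower: "\<And>K. 0 < K \<Longrightarrow> \<exists>\<epsilon>>0. \<forall>y k. inv_sum (Suc k) \<le> K * c (Suc y) \<longrightarrow> \<epsilon> * r y \<le> 1 / (c (Suc y) * d k)"
    and div: "\<not> summable (\<lambda>i. 1 / d i)"
  shows "AE \<omega> in M. recurrent_path (traj \<omega>)"
proof -
  have "AE \<omega> in M. \<not> (transient_path (traj \<omega>) \<and> walk_path (traj \<omega>) \<and> (\<forall>n. ups (traj \<omega>) n 0 < m))" for m
  proof -
    define f where "f = inv_sum m / c 1"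
    have f: "0 \<le> f" by (simp add: f_def inv_sum_nonneg c_nonneg)
    have "\<exists>L. \<forall>n. prob {\<omega> \<in> space M. L \<le> fst (frozen (returned m) (traj \<omega>) n)} \<le> e" if e: "0 < e" for e
    proof -
      (* Each of the two error terms f / (\<epsilon> * R) and f / K is made at most e / 2; the summand 1 covers f = 0. *)
      define K where "K = (2 * f + 1) / e"
      have K: "0 < K" "f / K \<le> e / 2" using f e by (auto simp: K_def field_simps)
      from lower[OF K(1)] obtain \<epsilon> where \<epsilon>: "\<epsilon> > 0"
        "\<And>y k. inv_sum (Suc k) \<le> K * c (Suc y) \<Longrightarrow> \<epsilon> * r y \<le> 1 / (c (Suc y) * d k)" by blast
      have "\<forall>\<^sub>F L in sequentially. (2 * f + 1) / (\<epsilon> * e) \<le> (\<Sum>y<L. r y)"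
        using sum_at_top_if_not_summable[OF r] by (simp add: filterlim_at_top)
      from eventually_happens'[OF sequentially_bot this]
      obtain L where L: "(2 * f + 1) / (\<epsilon> * e) \<le> (\<Sum>y<L. r y)" by blast
      define R where "R = (\<Sum>y<L. r y)"
      have R: "0 < R" "f / (\<epsilon> * R) \<le> e / 2"
      proof -
        have "0 < (2 * f + 1) / (\<epsilon> * e)" using f e \<epsilon> by simp
        with L show "0 < R" by (simp add: R_def)
        have "(2 * f + 1) \<le> \<epsilon> * e * R" using L e \<epsilon>(1) by (simp add: R_def field_simps)
        then show "f / (\<epsilon> * R) \<le> e / 2" using \<open>0 < R\<close> \<epsilon>(1) by (simp add: field_simps)
      qed
      have "prob {\<omega> \<in> space M. L \<le> fst (frozen (returned m) (traj \<omega>) n)} \<le> e" for n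
      proof -
        let ?p = "prob {\<omega> \<in> space M. L \<le> fst (frozen (returned m) (traj \<omega>) n)}"
        have "\<epsilon> * R * ?p \<le> f + \<epsilon> / K * R * f"
          unfolding R_def f_def by (rule high_unreturned_rarely[OF r(1) K(1) \<epsilon>])
        then have "?p \<le> f / (\<epsilon> * R) + f / K"
          using R(1) \<epsilon>(1) K(1) by (simp add: field_simps)
        then show ?thesis using R K by linarith
      qed
      then show ?thesis by blast
    qed
    then have "\<forall>e. \<exists>L. 0 < e \<longrightarrow>
        (\<forall>n. prob {\<omega> \<in> space M. L \<le> fst (frozen (returned m) (traj \<omega>) n)} \<le> e)" by blast
    from choice[OF this] obtain L where L: "\<forall>e. 0 < e \<longrightarrow>
        (\<forall>n. prob {\<omega> \<in> space M. L e \<le> fst (frozen (returned m) (traj \<omega>) n)} \<le> e)" by blast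
    show ?thesis
    proof (rule AE_not_if_rarely[where A = "\<lambda>e n. {\<omega> \<in> space M. L e \<le> fst (frozen (returned m) (traj \<omega>) n)}"])
      show "AE \<omega> in M. \<forall>e>0. transient_path (traj \<omega>) \<and> walk_path (traj \<omega>) \<and> (\<forall>n. ups (traj \<omega>) n 0 < m) \<longrightarrow>
          (\<forall>\<^sub>F n in sequentially. \<omega> \<in> {\<omega> \<in> space M. L e \<le> fst (frozen (returned m) (traj \<omega>) n)})"
      proof (rule AE_I2, intro allI impI, elim conjE)
        fix \<omega> and e :: real
        assume "\<omega> \<in> space M" "transient_path (traj \<omega>)" and p: "walk_path (traj \<omega>)"
          and "\<forall>n. ups (traj \<omega>) n 0 < m"
        then have "\<not> returned m (urn_state (traj \<omega>) n)" for n
          by (simp add: returned_def urn_state_eq[OF p] not_le)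
        then have "fst (frozen (returned m) (traj \<omega>) n) = X n \<omega>" for n
          by (subst frozen_never) (auto simp: urn_state_eq[OF p])
        moreover have "\<forall>\<^sub>F n in sequentially. L e \<le> X n \<omega>"
          using transient_path_at_top[OF \<open>transient_path (traj \<omega>)\<close>] by (simp add: filterlim_at_top)
        ultimately show "\<forall>\<^sub>F n in sequentially. \<omega> \<in> {\<omega> \<in> space M. L e \<le> fst (frozen (returned m) (traj \<omega>) n)}"
          using \<open>\<omega> \<in> space M\<close> by simp
      qed
    qed (use L sets_frozen in auto)
  qed
  then have "AE \<omega> in M. \<forall>m. \<not> (transient_path (traj \<omega>) \<and> walk_path (traj \<omega>) \<and> (\<forall>n. ups (traj \<omega>) n 0 < m))"
    unfolding AE_all_countable by blast
  with AE_recurrent_or_transient[OF div] AE_walk_path show ?thesis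
  proof eventually_elim
    case (elim \<omega>)
    have "inf_ups (traj \<omega>) 0"
    proof (rule ccontr)
      assume *: "\<not> inf_ups (traj \<omega>) 0"
      then have "transient_path (traj \<omega>)" using elim(1) by simp
      moreover obtain m where "\<forall>n. ups (traj \<omega>) n 0 < m"
        using * unfolding inf_ups_def not_all not_ex not_le by blast
      ultimately show False using elim(2,3) by blast
    qed
    then show ?case using elim(1) by simp
  qed
qed

end

section \<open>Localization on one edge\<close>

context urn_walk
begin

lemma consistent_up_count_Suc: "consistent s \<Longrightarrow> up_count z s = 0 \<Longrightarrow> up_count (Suc z) s = 0"
  by (cases s, hypsubst, unfold consistent_def prod.case fst_conv snd_conv, blast)

text \<open>
  Write \<open>x = z + 1\<close>. The function \<open>q z\<close> is a lower bound for the probability that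
  the walk, having entered \<open>x\<close> from below for the first time, goes back and forth between
  \<open>x\<close> and \<open>x + 1\<close> forever; it is set to \<open>0\<close> as soon as the walk has
  done anything else. It is a submartingale with starting value \<open>v 0 > 0\<close>, whatever
  \<open>z\<close> is. Hence each new level is followed by a level two steps higher with probability at most
  \<open>1 - v 0\<close>.
\<close>

lemma AE_localizes:
  assumes sum: "summable (\<lambda>i. 1 / d i)" and \<kappa>: "0 < \<kappa>"
    and c_left: "\<And>y. c y \<le> \<kappa> * c (Suc y)" and c_right: "\<And>y. c (Suc (Suc y)) \<le> \<kappa> * c (Suc y)"
  shows "AE \<omega> in M. localizes_on_single_edge (traj \<omega>)"
proof -
  define t where "t i = exp (- (\<kappa> * d 0 / d i))" for i
  (* t i bounds the probability of one more crossing of the edge from below, and v i the infinite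
     product of the squares of t i, t (i + 1), ..., one factor for each direction. *)
  define v where "v i = exp (- (2 * \<kappa> * d 0) * ((\<Sum>i. 1 / d i) - inv_sum i))" for i
  have v_step: "v i = t i * (t i * v (Suc i))" for i
    by (simp add: v_def t_def inv_sum_Suc exp_add[symmetric]) (simp add: algebra_simps)
  have v_pos: "0 < v i" for i by (simp add: v_def)
  have v_le: "v i \<le> 1" for i
  proof -
    have "inv_sum i \<le> (\<Sum>i. 1 / d i)"
      unfolding inv_sum_def by (rule sum_le_suminf[OF sum]) (auto simp: d_pos less_imp_le)
    then show ?thesis using \<kappa> d_pos[of 0] by (simp add: v_def)
  qed
  have t_pos: "0 < t i" for i by (simp add: t_def)
  have t_le: "t i \<le> 1" for i using \<kappa> d_pos by (simp add: t_def less_imp_le)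
  have t_prob: "t i \<le> a * d i / (a * d i + b * d 0)" if "0 < a" "0 \<le> b" "b \<le> \<kappa> * a" for a b i
  proof -
    have pos: "0 < d i" "0 < d 0" "0 < a * d i" using d_pos that by auto
    have "1 + b * d 0 / (a * d i) \<le> 1 + \<kappa> * a * d 0 / (a * d i)"
      using that pos by (intro add_left_mono divide_right_mono mult_right_mono) auto
    also have "\<dots> = 1 + \<kappa> * d 0 / d i" using that by simp
    also have "\<dots> \<le> exp (\<kappa> * d 0 / d i)" by (rule exp_ge_add_one_self)
    finally have "1 + b * d 0 / (a * d i) \<le> exp (\<kappa> * d 0 / d i)" .
    moreover have "0 < 1 + b * d 0 / (a * d i)"
      using that pos by (intro add_pos_nonneg) auto
    ultimately have "inverse (exp (\<kappa> * d 0 / d i)) \<le> inverse (1 + b * d 0 / (a * d i))"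
      by (intro le_imp_inverse_le)
    also have "\<dots> = a * d i / (a * d i + b * d 0)"
      using pos that by (simp add: field_simps)
    finally show ?thesis by (simp add: t_def exp_minus)
  qed
  define q :: "nat \<Rightarrow> urn_config \<Rightarrow> real" where "q z = (\<lambda>(x, k, j).
    if k z = 1 \<and> k (Suc (Suc z)) = 0 then
      if x = Suc z then v (k (Suc z))
      else if x = Suc (Suc z) then t (k (Suc z) - 1) * v (k (Suc z)) else 0
    else 0)" for z
  have q_nonneg: "0 \<le> q z s" for z s
    using v_pos t_pos by (auto simp: q_def less_imp_le split: prod.splits)
  have q_le: "q z s \<le> 1" for z s
    using v_le t_le mult_le_one[OF t_le less_imp_le[OF v_pos] v_le] by (auto simp: q_def split: prod.splits)
  have q_step: "q z s \<le> transition (q z) s" if cons: "consistent s" for z s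
  proof -
    obtain x k j where s: "s = (x, k, j)" by (cases s)
    have kj: "k y = j (Suc y) + of_bool (y < x)" for y using cons by (simp add: consistent_def s)
    have nonneg: "0 \<le> up_prob s * q z (up_state s)" "0 \<le> (1 - up_prob s) * q z (down_state s)"
      using up_prob_bounds[of s] q_nonneg by auto
    have "q z s = 0 \<or> (k z = 1 \<and> k (Suc (Suc z)) = 0 \<and> x = Suc z) \<or>
        (k z = 1 \<and> k (Suc (Suc z)) = 0 \<and> x = Suc (Suc z))"
      by (simp add: q_def s)
    then consider "q z s = 0" | "k z = 1" "k (Suc (Suc z)) = 0" "x = Suc z"
      | "k z = 1" "k (Suc (Suc z)) = 0" "x = Suc (Suc z)"
      by metis
    then show ?thesis
    proof cases
      case 1
      then show ?thesis using nonneg by (simp add: transition_def)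
    next
      case 2
      have "j x = 0" using kj[of z] 2 by simp
      then have "t (k x) \<le> up_prob s"
        using t_prob[of "c (Suc x)" "c x" "k x"] c_pos c_nonneg c_left by (simp add: up_prob_def s)
      moreover have "q z (up_state s) = t (k x) * v (Suc (k x))" using 2 by (simp add: q_def s)
      moreover have "q z s = t (k x) * (t (k x) * v (Suc (k x)))"
        using 2 by (simp add: q_def s v_step[symmetric])
      ultimately have "q z s \<le> up_prob s * q z (up_state s)"
        using t_pos v_pos by (simp add: mult_right_mono less_imp_le)
      then show ?thesis using nonneg by (simp add: transition_def)
    next
      case 3
      define i where "i = j x"
      have k: "k (Suc z) = Suc i" using kj[of "Suc z"] 3 by (simp add: i_def)
      have "1 - up_prob s = c x * d i / (c x * d i + c (Suc x) * d 0)"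
      proof -
        have "0 < c (Suc x) * d 0 + c x * d i" using c_pos d_pos c_nonneg by (simp add: add_pos_nonneg less_imp_le)
        then show ?thesis using 3 by (simp add: up_prob_def s i_def field_simps)
      qed
      then have "t i \<le> 1 - up_prob s"
        using t_prob[of "c x" "c (Suc x)" i] c_pos c_nonneg c_right 3 by simp
      moreover have "q z (down_state s) = v (Suc i)" using 3 k by (simp add: q_def s)
      moreover have "q z s = t i * v (Suc i)" using 3 k by (simp add: q_def s)
      ultimately have "q z s \<le> (1 - up_prob s) * q z (down_state s)"
        using v_pos by (simp add: mult_right_mono less_imp_le)
      then show ?thesis using nonneg by (simp add: transition_def)
    qed
  qed
  define p where "p z n = prob {\<omega> \<in> space M. 0 < up_count z (frozen (\<lambda>_. False) (traj \<omega>) n)}" for z n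
  have p_eq: "p z n = stopped_expectation (\<lambda>_. False) n (\<lambda>s. of_bool (0 < up_count z s))" for z n
    unfolding p_def by (rule stopped_expectation_of_bool[symmetric])
  have "p (Suc (Suc z)) n \<le> (1 - v 0) * p z n" for z n
  proof -
    let ?E = "stopped_expectation (\<lambda>_. False) n"
    (* H vanishes until the vertex Suc z is reached, and also at that moment, when q z s = v 0;
       afterwards v 0 - q z s is a supermartingale. *)
    define H where "H s = of_bool (0 < up_count z s) * (v 0 - q z s)" for s
    have "?E H \<le> H (0, (\<lambda>_. 0), (\<lambda>_. 0))"
    proof (rule stopped_supermartingale)
      fix s assume cons: "consistent s"
      obtain x k j where s: "s = (x, k, j)" by (cases s)
      show "transition H s \<le> H s"
      proof (cases "k z = 0")
        case True
        have "k z = j (Suc z) + of_bool (z < x)" using cons by (simp add: consistent_def s)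
        with True have "x \<le> z" by (simp split: if_splits add: of_bool_def)
        moreover have "k (Suc z) = 0" "k (Suc (Suc z)) = 0" using cons True by (auto simp: consistent_def s)
        ultimately have "H (up_state s) = 0" "H (down_state s) = 0" "H s = 0"
          using True by (auto simp: H_def s q_def)
        then show ?thesis by (simp add: transition_def)
      next
        case False
        then have H: "H (up_state s) = v 0 - q z (up_state s)" "H (down_state s) = v 0 - q z (down_state s)"
          "H s = v 0 - q z s" by (auto simp: H_def s)
        have "transition H s = v 0 - transition (q z) s"
          unfolding transition_def H by (simp add: algebra_simps)
        then show ?thesis using q_step[OF cons, of z] H(3) by simp
      qed
    qed
    then have "?E H \<le> 0" by (simp add: H_def)
    moreover have "?E (\<lambda>s. v 0 * of_bool (0 < up_count z s) - (of_bool (0 < up_count z s) - of_bool (0 < up_count (Suc (Suc z)) s))) \<le> ?E H"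
    proof (rule stopped_expectation_mono)
      fix p' assume p': "walk_path p'"
      let ?s = "frozen (\<lambda>_. False) p' n"
      have "0 < up_count z ?s" if "0 < up_count (Suc (Suc z)) ?s"
      proof (rule ccontr)
        assume "\<not> 0 < up_count z ?s"
        then have "up_count z ?s = 0" by (rule not_gr_zero[THEN iffD1])
        then have "up_count (Suc (Suc z)) ?s = 0"
          by (intro consistent_up_count_Suc consistent_frozen[OF p'])
        with that show False by (simp only: less_irrefl)
      qed
      moreover have "q z ?s = 0" if "0 < up_count (Suc (Suc z)) ?s"
        using that by (cases ?s) (simp add: q_def del: frozen_False)
      ultimately show "v 0 * of_bool (0 < up_count z ?s) - (of_bool (0 < up_count z ?s) - of_bool (0 < up_count (Suc (Suc z)) ?s)) \<le> H ?s"
        using q_le[of z ?s] by (auto simp: H_def simp del: frozen_False)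
    qed
    ultimately have "?E (\<lambda>s. v 0 * of_bool (0 < up_count z s) - (of_bool (0 < up_count z s) - of_bool (0 < up_count (Suc (Suc z)) s))) \<le> 0"
      by linarith
    then have "v 0 * p z n - (p z n - p (Suc (Suc z)) n) \<le> 0"
      by (simp only: stopped_expectation_diff stopped_expectation_cmult p_eq)
    then show ?thesis by (simp add: algebra_simps)
  qed
  note p_step = this
  have p_le: "p (2 * i) n \<le> (1 - v 0) ^ i" for i n
  proof (induction i)
    case (Suc i)
    have "p (2 * Suc i) n \<le> (1 - v 0) * p (2 * i) n" using p_step[of "2 * i" n] by simp
    also have "\<dots> \<le> (1 - v 0) * (1 - v 0) ^ i" using Suc v_le[of 0] by (intro mult_left_mono) auto
    finally show ?case by simp
  qed (simp add: p_def)
  have "AE \<omega> in M. \<not> (\<forall>L. \<exists>n. L < X n \<omega>)"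
  proof -
    have "(\<lambda>i. (1 - v 0) ^ i) \<longlonglongrightarrow> 0"
      using v_pos[of 0] v_le[of 0] by (intro LIMSEQ_realpow_zero) auto
    then have "\<forall>e. \<exists>i. 0 < e \<longrightarrow> (1 - v 0) ^ i < e"
      using order_tendstoD(2)[of _ 0 sequentially] eventually_happens'[OF sequentially_bot] by blast
    from choice[OF this] obtain i where i: "\<And>e. 0 < e \<Longrightarrow> (1 - v 0) ^ i e < e" by blast
    show ?thesis
    proof (rule AE_not_if_rarely[where A = "\<lambda>e n. {\<omega> \<in> space M. 0 < up_count (2 * i e) (frozen (\<lambda>_. False) (traj \<omega>) n)}"])
      show "prob {\<omega> \<in> space M. 0 < up_count (2 * i e) (frozen (\<lambda>_. False) (traj \<omega>) n)} \<le> e" if "0 < e" for e n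
        using p_le[of "i e" n] i[OF that] by (simp add: p_def)
      show "AE \<omega> in M. \<forall>e>0. (\<forall>L. \<exists>n. L < X n \<omega>) \<longrightarrow> (\<forall>\<^sub>F n in sequentially.
          \<omega> \<in> {\<omega> \<in> space M. 0 < up_count (2 * i e) (frozen (\<lambda>_. False) (traj \<omega>) n)})"
        using AE_walk_path AE_space
      proof eventually_elim
        case (elim \<omega>)
        show ?case
        proof (intro allI impI)
          fix e :: real assume "\<forall>L. \<exists>n. L < X n \<omega>"
          then obtain m where "2 * i e < X m \<omega>" by blast
          then have "0 < ups (traj \<omega>) m (2 * i e)" using ups_eq_downs[OF elim(1), of m "2 * i e"] by simp
          then have "0 < ups (traj \<omega>) n (2 * i e)" if "m \<le> n" for n
            using ups_mono[OF elim(1) that, of "2 * i e"] by linarith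
          then show "\<forall>\<^sub>F n in sequentially. \<omega> \<in> {\<omega> \<in> space M. 0 < up_count (2 * i e) (frozen (\<lambda>_. False) (traj \<omega>) n)}"
            using elim(2) unfolding eventually_sequentially by (auto simp: ups_def)
        qed
      qed
    qed (rule sets_frozen)
  qed
  moreover have "AE \<omega> in M. \<forall>y. 0 < y \<longrightarrow> \<not> (inf_ups (traj \<omega>) y \<and> inf_downs (traj \<omega>) y)"
    unfolding AE_all_countable
  proof
    show "AE \<omega> in M. 0 < y \<longrightarrow> \<not> (inf_ups (traj \<omega>) y \<and> inf_downs (traj \<omega>) y)" for y
      by (cases "0 < y") (use AE_urn_fixates[OF _ sum, of y] in auto)
  qed
  ultimately show ?thesis using AE_walk_path
  proof eventually_elim
    case (elim \<omega>)
    then obtain N where "\<And>n. X n \<omega> \<le> N" unfolding not_all not_ex not_less by blast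
    then show ?case using single_edge_if_fixation[OF elim(3)] elim(2) by blast
  qed
qed

end

section \<open>From edge weights to urns\<close>

lemma traversals_eq:
  assumes "walk_path p"
  shows "traversals p n y = ups p n y + downs p n (Suc y)"
proof (induction n)
  case (Suc n)
  have step: "p (Suc n) = Suc (p n) \<or> p n = Suc (p (Suc n))"
    using assms by (simp add: walk_path_def)
  have "traversals p (Suc n) y = traversals p n y + of_bool ({p n, p (Suc n)} = {y, y + 1})"
    by (simp add: traversals_def)
  also have "of_bool ({p n, p (Suc n)} = {y, y + 1}) =
      of_bool (p n = y \<and> p (Suc n) = Suc y) + (of_bool (p n = Suc y \<and> Suc y = Suc (p (Suc n))) :: nat)"
    using step by (auto simp: of_bool_def doubleton_eq_iff)
  finally show ?case using Suc by (simp add: ups_Suc[OF assms] downs_Suc[OF assms])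
qed (simp add: traversals_def)

text \<open>
  At its current position the walk has crossed the edge above an even and the edge below an odd number of
  times, so the pairing of the reinforcement factors turns crossings into departures.
\<close>

lemma edge_weights_down_only:
  assumes p: "walk_path p"
    and f: "\<And>l x. f l x = \<delta> l * c (Suc x)" and c0: "c 0 = 0"
    and even: "\<And>i. \<delta> (2 * i) = d i" and odd: "\<And>i. \<delta> (2 * i + 1) = d i"
  shows "edge_weight f p n (int (p n)) = c (Suc (p n)) * d (ups p n (p n))"
    and "edge_weight f p n (int (p n) - 1) = c (p n) * d (downs p n (p n))"
proof -
  have "traversals p n (p n) = 2 * ups p n (p n)"
    using ups_eq_downs[OF p, of n "p n"] by (simp add: traversals_eq[OF p])
  then show "edge_weight f p n (int (p n)) = c (Suc (p n)) * d (ups p n (p n))"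
    by (simp add: edge_weight_def f even)
  show "edge_weight f p n (int (p n) - 1) = c (p n) * d (downs p n (p n))"
  proof (cases "p n")
    case 0
    then show ?thesis by (simp add: edge_weight_def c0)
  next
    case (Suc z)
    have "traversals p n z = 2 * downs p n (p n) + 1"
      using ups_eq_downs[OF p, of n z] Suc by (simp add: traversals_eq[OF p])
    then have "\<delta> (traversals p n z) = d (downs p n (p n))" using odd by simp
    then show ?thesis using Suc by (simp add: edge_weight_def f)
  qed
qed

lemma (in edge_reinforced_random_walk) urn_walk_if_down_only:
  assumes f: "\<And>l x. f l x = \<delta> l * c (Suc x)" and c0: "c 0 = 0" and c: "\<And>y. 0 < c (Suc y)"
    and even: "\<And>i. \<delta> (2 * i) = d i" and odd: "\<And>i. \<delta> (2 * i + 1) = d i"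
    and d: "\<And>i. 0 < d i" "mono d"
  shows "urn_walk M X c d"
proof -
  have "AE \<omega> in M. \<forall>n. \<bar>int (X (Suc n) \<omega>) - int (X n \<omega>)\<bar> = 1"
    unfolding AE_all_countable using nearest_neighbour by blast
  with start have path: "AE \<omega> in M. walk_path (\<lambda>n. X n \<omega>)"
  proof eventually_elim
    case (elim \<omega>)
    show ?case unfolding walk_path_def
    proof (intro conjI allI)
      fix n
      have "\<bar>int (X (Suc n) \<omega>) - int (X n \<omega>)\<bar> = 1" using elim(2) by blast
      then show "X (Suc n) \<omega> = Suc (X n \<omega>) \<or> X n \<omega> = Suc (X (Suc n) \<omega>)" by linarith
    qed (rule elim(1))
  qed
  show ?thesis
  proof (unfold_locales)
    fix n and g :: "(nat \<Rightarrow> nat) \<Rightarrow> real"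
    assume g: "depends_upto n g"
    define U where "U = {\<omega> \<in> space M. int (X (Suc n) \<omega>) = int (X n \<omega>) + 1}"
    define q where "q \<omega> = (case urn_state (\<lambda>i. X i \<omega>) n of (x, k, j) \<Rightarrow>
        c (Suc x) * d (k x) / (c (Suc x) * d (k x) + c x * d (j x)))" for \<omega>
    have sub: "subalgebra M (history M X n)" by (rule subalgebra_history[OF measurable_walk])
    interpret sigma_finite_subalgebra M "history M X n"
      by (rule finite_measure_subalgebra_is_sigma_finite)
        (simp add: finite_measure_subalgebra_def finite_measure_subalgebra_axioms_def sub finite_measure_axioms)
    have ind: "indicator U \<omega> = (of_bool (X (Suc n) \<omega> = Suc (X n \<omega>)) :: real)" if "\<omega> \<in> space M" for \<omega>
      using that by (auto simp: U_def indicator_def)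
    have gU: "depends_upto (Suc n) (\<lambda>p. g p * of_bool (p (Suc n) = Suc (p n)))"
      by (rule depends_upto_combine[of _ _ _ "(*)"])
        (use g in \<open>auto simp: depends_upto_def\<close>)
    have mg: "(\<lambda>\<omega>. g (\<lambda>i. X i \<omega>)) \<in> borel_measurable (history M X n)"
      by (rule measurable_history[OF measurable_walk g])
    have int: "integrable M (\<lambda>\<omega>. g (\<lambda>i. X i \<omega>) * of_bool (X (Suc n) \<omega> = Suc (X n \<omega>)))"
      using integrable_path_functional[OF measurable_walk path gU] by simp
    have U: "U \<in> sets M"
    proof -
      have [measurable]: "X i \<in> measurable M (count_space UNIV)" for i by (rule measurable_walk)
      show ?thesis unfolding U_def by measurable
    qed
    have "integrable M (\<lambda>\<omega>. g (\<lambda>i. X i \<omega>) * indicator U \<omega>)"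
      using int by (rule Bochner_Integration.integrable_cong[THEN iffD1, rotated 2]) (auto simp: ind)
    note cond = real_cond_exp_intg[OF this mg borel_measurable_indicator[OF U]]
    have AE_q: "AE \<omega> in M. real_cond_exp M (history M X n) (indicator U) \<omega> = q \<omega>"
      using step_up[of n] path
    proof eventually_elim
      case (elim \<omega>)
      show ?case
        using elim(1) edge_weights_down_only[OF elim(2) f c0 even odd, of n]
        by (simp add: U_def q_def urn_state_eq[OF elim(2)] Let_def add.commute)
    qed
    have "expectation (\<lambda>\<omega>. g (\<lambda>i. X i \<omega>) * of_bool (X (Suc n) \<omega> = Suc (X n \<omega>))) =
        expectation (\<lambda>\<omega>. g (\<lambda>i. X i \<omega>) * indicator U \<omega>)"
      by (rule Bochner_Integration.integral_cong) (auto simp: ind)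
    also have "\<dots> = expectation (\<lambda>\<omega>. g (\<lambda>i. X i \<omega>) * real_cond_exp M (history M X n) (indicator U) \<omega>)"
      by (rule cond(2)[symmetric])
    also have "\<dots> = expectation (\<lambda>\<omega>. g (\<lambda>i. X i \<omega>) * q \<omega>)"
    proof (rule integral_cong_AE)
      show "(\<lambda>\<omega>. g (\<lambda>i. X i \<omega>) * real_cond_exp M (history M X n) (indicator U) \<omega>) \<in> borel_measurable M"
        by (rule borel_measurable_integrable[OF cond(1)])
      have "depends_upto n (\<lambda>p. g p * (case urn_state p n of (x, k, j) \<Rightarrow>
          c (Suc x) * d (k x) / (c (Suc x) * d (k x) + c x * d (j x))))"
        by (rule depends_upto_combine[OF g depends_upto_urn_state])
      from borel_measurable_integrable[OF integrable_path_functional[OF measurable_walk path this]]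
      show "(\<lambda>\<omega>. g (\<lambda>i. X i \<omega>) * q \<omega>) \<in> borel_measurable M" by (simp add: q_def)
    qed (use AE_q in auto)
    finally show "expectation (\<lambda>\<omega>. g (\<lambda>i. X i \<omega>) * of_bool (X (Suc n) \<omega> = Suc (X n \<omega>))) =
        expectation (\<lambda>\<omega>. g (\<lambda>i. X i \<omega>) * (case urn_state (\<lambda>i. X i \<omega>) n of (x, k, j) \<Rightarrow>
          c (Suc x) * d (k x) / (c (Suc x) * d (k x) + c x * d (j x))))"
      by (simp add: q_def)
  qed (use measurable_walk path c0 c d in auto)
qed

section \<open>Power weights\<close>

text \<open>
  Concavity of \<open>\<lambda>x. x powr \<beta>\<close>, from the weighted inequality of arithmetic and
  geometric means.
\<close>

lemma powr_Suc_diff_ge: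
  fixes \<beta> :: real
  assumes "0 < \<beta>" "\<beta> \<le> 1"
  shows "\<beta> * real (Suc k) powr (\<beta> - 1) \<le> real (Suc k) powr \<beta> - real k powr \<beta>"
proof (cases "k = 0")
  case False
  define n where "n = real (Suc k)"
  have n: "1 < n" "real k = n - 1" using False by (auto simp: n_def)
  have "((n - 1) / n) powr \<beta> * 1 powr (1 - \<beta>) \<le> \<beta> * ((n - 1) / n) + (1 - \<beta>) * 1"
    using assms n by (intro Youngs_inequality_0) auto
  then have "((n - 1) / n) powr \<beta> \<le> 1 - \<beta> / n" using n by (simp add: field_simps)
  then have "((n - 1) / n) powr \<beta> * n powr \<beta> \<le> (1 - \<beta> / n) * n powr \<beta>"
    by (rule mult_right_mono) simp
  moreover have "((n - 1) / n) powr \<beta> * n powr \<beta> = (n - 1) powr \<beta>"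
    using n by (simp add: powr_divide)
  moreover have "(1 - \<beta> / n) * n powr \<beta> = n powr \<beta> - \<beta> * n powr (\<beta> - 1)"
    using n by (simp add: powr_diff algebra_simps)
  ultimately show ?thesis unfolding n_def[symmetric] n(2) by linarith
qed (use assms in simp)

lemma sum_powr_le:
  fixes \<beta> :: real
  assumes "0 < \<beta>" "\<beta> \<le> 1"
  shows "(\<Sum>i<k. real (Suc i) powr (\<beta> - 1)) \<le> real k powr \<beta> / \<beta>"
proof (induction k)
  case (Suc k)
  have "real (Suc k) powr (\<beta> - 1) \<le> (real (Suc k) powr \<beta> - real k powr \<beta>) / \<beta>"
    using powr_Suc_diff_ge[OF assms, of k] assms by (simp add: pos_le_divide_eq mult.commute)
  with Suc have "(\<Sum>i<Suc k. real (Suc i) powr (\<beta> - 1)) \<le>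
      real k powr \<beta> / \<beta> + (real (Suc k) powr \<beta> - real k powr \<beta>) / \<beta>" by simp
  also have "\<dots> = real (Suc k) powr \<beta> / \<beta>" by (simp add: diff_divide_distrib)
  finally show ?case .
qed simp

lemma sum_powr_ge:
  fixes \<rho> :: real
  assumes "0 \<le> \<rho>"
  shows "real k powr (1 - \<rho>) \<le> (\<Sum>i<k. 1 / real (Suc i) powr \<rho>)"
proof (cases "k = 0")
  case False
  have "real k powr (1 - \<rho>) = (\<Sum>i<k. 1 / real k powr \<rho>)"
    using False by (simp add: powr_diff)
  also have "\<dots> \<le> (\<Sum>i<k. 1 / real (Suc i) powr \<rho>)"
    using assms by (intro sum_mono divide_left_mono powr_mono2) auto
  finally show ?thesis .
qed simp

lemma summable_powr_Suc_iff: "summable (\<lambda>y. real (Suc y) powr s) \<longleftrightarrow> s < -1"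
  using summable_Suc_iff[of "\<lambda>n. real n powr s"] summable_real_powr_iff[of s] by simp

lemma summable_inverse_powr_Suc_iff: "summable (\<lambda>y. 1 / real (Suc y) powr s) \<longleftrightarrow> 1 < s"
  using summable_powr_Suc_iff[of "- s"] by (simp add: powr_minus divide_inverse)

locale power_urn_walk = urn_walk M X "\<lambda>y. real y powr \<alpha>" "\<lambda>i. real (Suc i) powr \<rho>"
  for M :: "'a measure" and X and \<alpha> \<rho> :: real +
  assumes \<alpha>: "1 / 2 < \<alpha>" "\<alpha> \<le> 1" and \<rho>: "0 \<le> \<rho>"
begin

lemma inv_sum_ge: "real k powr (1 - \<rho>) \<le> inv_sum k"
  unfolding inv_sum_def by (rule sum_powr_ge[OF \<rho>])

lemma inv_sq_sum_eq: "inv_sq_sum k = (\<Sum>i<k. real (Suc i) powr (- 2 * \<rho>))"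
  unfolding inv_sq_sum_def by (simp add: powr_power powr_minus divide_inverse mult.commute)

text \<open>
  As \<open>inv_sum k \<ge> k powr (1 - \<rho>)\<close> and \<open>\<alpha> \<le> 1 - \<rho>\<close>, a
  bound \<open>inv_sum k \<le> K * (y + 1) powr \<alpha>\<close> forces \<open>k\<close> to be at most a
  multiple of \<open>y + 1\<close>, and then the weight \<open>(y + 1) powr \<alpha> * k powr \<rho>\<close>
  is at most a multiple of \<open>y + 1\<close>.
\<close>

lemma weak_reinforcement_recurrent:
  assumes "\<rho> \<le> 1 - \<alpha>"
  shows "AE \<omega> in M. recurrent_path (traj \<omega>)"
proof (rule AE_recurrent)
  show "\<not> summable (\<lambda>y. real (Suc y) powr - 1)" by (simp only: summable_powr_Suc_iff)
  show "\<not> summable (\<lambda>i. 1 / real (Suc i) powr \<rho>)"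
    unfolding summable_inverse_powr_Suc_iff using assms \<alpha> by simp
next
  fix K :: real assume K: "0 < K"
  define K' where "K' = K powr (\<rho> / (1 - \<rho>))"
  have "\<rho> < 1" using assms \<alpha> by simp
  have "1 / K' * real (Suc y) powr - 1 \<le> 1 / (real (Suc y) powr \<alpha> * real (Suc k) powr \<rho>)"
    if "inv_sum (Suc k) \<le> K * real (Suc y) powr \<alpha>" for y k
  proof -
    have "real (Suc k) powr (1 - \<rho>) \<le> inv_sum (Suc k)" by (rule inv_sum_ge)
    also have "\<dots> \<le> K * real (Suc y) powr (1 - \<rho>)"
      using assms K by (intro order_trans[OF that] mult_left_mono powr_mono) auto
    finally have "(real (Suc k) powr (1 - \<rho>)) powr (\<rho> / (1 - \<rho>)) \<le>
        (K * real (Suc y) powr (1 - \<rho>)) powr (\<rho> / (1 - \<rho>))"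
      using \<rho> \<open>\<rho> < 1\<close> by (intro powr_mono2) auto
    then have "real (Suc k) powr \<rho> \<le> K' * real (Suc y) powr \<rho>"
      using K \<open>\<rho> < 1\<close> by (simp add: powr_powr powr_mult K'_def)
    then have "real (Suc y) powr \<alpha> * real (Suc k) powr \<rho> \<le> real (Suc y) powr \<alpha> * (K' * real (Suc y) powr \<rho>)"
      by (rule mult_left_mono) simp
    also have "\<dots> = K' * real (Suc y) powr (\<alpha> + \<rho>)" by (simp add: powr_add)
    also have "\<dots> \<le> K' * real (Suc y) powr 1"
      using assms by (intro mult_left_mono powr_mono) (auto simp: K'_def)
    finally have "1 / (K' * real (Suc y) powr 1) \<le> 1 / (real (Suc y) powr \<alpha> * real (Suc k) powr \<rho>)"
      using K by (intro divide_left_mono mult_pos_pos) (auto simp: K'_def)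
    then show ?thesis by (simp add: powr_minus divide_inverse)
  qed
  moreover have "1 / K' > 0" using K by (simp add: K'_def)
  ultimately show "\<exists>\<epsilon>>0. \<forall>y k. inv_sum (Suc k) \<le> K * real (Suc y) powr \<alpha> \<longrightarrow>
      \<epsilon> * real (Suc y) powr - 1 \<le> 1 / (real (Suc y) powr \<alpha> * real (Suc k) powr \<rho>)" by blast
qed simp

text \<open>
  For \<open>\<rho> > 1 / 2\<close> the squared jumps are summable and \<open>\<gamma> = 0\<close> works,
  since \<open>2 * \<alpha> > 1\<close>. For \<open>\<rho> \<le> 1 / 2\<close> the sum of the squared jumps
  grows like \<open>k powr (1 - 2 * \<rho>)\<close> (logarithmically if \<open>\<rho> = 1 / 2\<close>),
  while \<open>inv_sum k\<close> is at least \<open>k powr (1 - \<rho>)\<close>. The two conditions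
  \<open>\<gamma> * (1 - \<rho>) > 1 - 2 * \<rho>\<close> and \<open>\<gamma> < 2 - 1 / \<alpha>\<close> are
  compatible exactly when \<open>1 - \<alpha> < \<rho>\<close>.
\<close>

lemma medium_reinforcement_transient:
  assumes "1 - \<alpha> < \<rho>" "\<rho> \<le> 1"
  shows "AE \<omega> in M. transient_path (traj \<omega>)"
proof -
  have div: "\<not> summable (\<lambda>i. 1 / real (Suc i) powr \<rho>)"
    unfolding summable_inverse_powr_Suc_iff using assms by simp
  have sum: "summable (\<lambda>y. (real (Suc y) powr \<alpha>) powr (\<gamma> - 2))" if "\<gamma> < 2 - 1 / \<alpha>" for \<gamma>
  proof -
    have "\<alpha> * \<gamma> < 2 * \<alpha> - 1" using that \<alpha> by (simp add: field_simps)
    then have "\<alpha> * (\<gamma> - 2) < - 1" by (simp add: algebra_simps)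
    then show ?thesis by (simp only: powr_powr summable_powr_Suc_iff)
  qed
  show ?thesis
  proof (cases "\<rho> \<le> 1 / 2")
    case False
    define C where "C = (\<Sum>i. real (Suc i) powr (- 2 * \<rho>))"
    have sm: "summable (\<lambda>i. real (Suc i) powr (- 2 * \<rho>))"
      unfolding summable_powr_Suc_iff using False by simp
    show ?thesis
    proof (rule AE_transient[where \<gamma> = 0 and C = C, OF _ _ _ _ sum div])
      show "0 \<le> C" unfolding C_def by (rule suminf_nonneg[OF sm]) simp
      show "inv_sq_sum k \<le> C * inv_sum k powr 0" for k
      proof (cases "k = 0")
        case False
        have "0 < real k powr (1 - \<rho>)" using False by simp
        then have "inv_sum k \<noteq> 0" using inv_sum_ge[of k] by linarith
        moreover have "inv_sq_sum k \<le> C"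
          unfolding inv_sq_sum_eq C_def by (rule sum_le_suminf[OF sm]) auto
        ultimately show ?thesis by simp
      qed (simp add: inv_sq_sum_def del: of_nat_Suc)
    qed (use \<alpha> in \<open>auto simp: field_simps\<close>)
  next
    case True
    (* The midpoint of the range that is left for \<beta> = \<gamma> * (1 - \<rho>). *)
    define \<beta> where "\<beta> = ((1 - 2 * \<rho>) + (1 - \<rho>) * (2 - 1 / \<alpha>)) / 2"
    define \<gamma> where "\<gamma> = \<beta> / (1 - \<rho>)"
    have "(1 - \<rho>) * (2 - 1 / \<alpha>) - (1 - 2 * \<rho>) = (\<alpha> + \<rho> - 1) / \<alpha>"
      using \<alpha> by (simp add: field_simps)
    moreover have "(\<alpha> + \<rho> - 1) / \<alpha> > 0" using \<alpha> assms by simp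
    ultimately have \<beta>: "1 - 2 * \<rho> < \<beta>" "\<beta> < (1 - \<rho>) * (2 - 1 / \<alpha>)" by (auto simp: \<beta>_def)
    have "1 / \<alpha> \<ge> 1" using \<alpha> by simp
    have "0 < \<beta>" using \<beta>(1) True by linarith
    have \<gamma>_less: "\<gamma> < 2 - 1 / \<alpha>" using \<beta>(2) True by (simp add: \<gamma>_def pos_divide_less_eq mult.commute)
    have "0 \<le> \<gamma>" using \<open>0 < \<beta>\<close> True by (simp add: \<gamma>_def)
    moreover have "\<gamma> \<le> 1" using \<gamma>_less \<open>1 / \<alpha> \<ge> 1\<close> by linarith
    ultimately have \<gamma>: "0 \<le> \<gamma>" "\<gamma> \<le> 1" .
    have \<beta>_eq: "(1 - \<rho>) * \<gamma> = \<beta>" using True by (simp add: \<gamma>_def)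
    have "\<beta> \<le> 1"
      using mult_mono[of "1 - \<rho>" 1 \<gamma> 1] \<gamma> \<rho> True \<beta>_eq by simp
    show ?thesis
    proof (rule AE_transient[OF \<gamma> _ _ sum[OF \<gamma>_less] div])
      show "0 \<le> 1 / \<beta>" using \<open>0 < \<beta>\<close> by simp
      fix k
      have "inv_sq_sum k \<le> (\<Sum>i<k. real (Suc i) powr (\<beta> - 1))"
        unfolding inv_sq_sum_eq using \<beta>(1) by (intro sum_mono powr_mono) auto
      also have "\<dots> \<le> real k powr \<beta> / \<beta>" by (rule sum_powr_le) fact+
      also have "real k powr \<beta> = (real k powr (1 - \<rho>)) powr \<gamma>" by (simp add: powr_powr \<beta>_eq)
      also have "\<dots> / \<beta> \<le> inv_sum k powr \<gamma> / \<beta>"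
        using \<open>0 < \<beta>\<close> \<gamma> by (intro divide_right_mono powr_mono2 inv_sum_ge) auto
      finally show "inv_sq_sum k \<le> 1 / \<beta> * inv_sum k powr \<gamma>" by simp
    qed
  qed
qed

lemma strong_reinforcement_localizes:
  assumes "1 < \<rho>"
  shows "AE \<omega> in M. localizes_on_single_edge (traj \<omega>)"
proof (rule AE_localizes)
  show "summable (\<lambda>i. 1 / real (Suc i) powr \<rho>)"
    unfolding summable_inverse_powr_Suc_iff by (rule assms)
  show "real y powr \<alpha> \<le> 2 * real (Suc y) powr \<alpha>" for y
  proof -
    have "real y powr \<alpha> \<le> real (Suc y) powr \<alpha>" using \<alpha> by (intro powr_mono2) auto
    also have "\<dots> \<le> 2 * real (Suc y) powr \<alpha>" by simp
    finally show ?thesis .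
  qed
  show "real (Suc (Suc y)) powr \<alpha> \<le> 2 * real (Suc y) powr \<alpha>" for y
  proof -
    have "real (Suc (Suc y)) powr \<alpha> \<le> (2 * real (Suc y)) powr \<alpha>" using \<alpha> by (intro powr_mono2) auto
    also have "\<dots> = 2 powr \<alpha> * real (Suc y) powr \<alpha>" by (rule powr_mult)
    also have "\<dots> \<le> 2 powr 1 * real (Suc y) powr \<alpha>" using \<alpha> by (intro mult_right_mono powr_mono) auto
    finally show ?thesis by simp
  qed
qed simp

end

theorem theorem2:
  fixes M :: "'a measure" and f :: "nat \<Rightarrow> nat \<Rightarrow> real" and X :: "nat \<Rightarrow> 'a \<Rightarrow> nat"
    and \<delta> :: "nat \<Rightarrow> real" and \<alpha> \<rho> :: real
  assumes "edge_reinforced_random_walk M f X"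
    and "factor_type \<delta> f"
    and "down_only_type \<delta>"
    and "\<And>x. f 0 x = real (x + 1) powr \<alpha>"
    and "\<And>k. \<delta> (2 * k) = real (k + 1) powr \<rho>"
    and "\<alpha> \<in> {1/2<..1}"
    and "\<rho> \<in> {0..}"
  shows "(\<rho> \<in> {0..1 - \<alpha>} \<longrightarrow> (AE \<omega> in M. recurrent_path (\<lambda>n. X n \<omega>))) \<and>
    (\<rho> \<in> {1 - \<alpha><..1/2} \<and> \<rho> > (3/2 - \<alpha>) / (5/2 - \<alpha>) \<longrightarrow>
      (AE \<omega> in M. transient_path (\<lambda>n. X n \<omega>))) \<and>
    (\<rho> \<in> {1/2<..1} \<longrightarrow> (AE \<omega> in M. transient_path (\<lambda>n. X n \<omega>))) \<and>
    (\<rho> \<in> {1<..} \<longrightarrow> (AE \<omega> in M. localizes_on_single_edge (\<lambda>n. X n \<omega>)))"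
proof -
  interpret edge_reinforced_random_walk M f X by fact
  have odd: "\<delta> (2 * i + 1) = real (i + 1) powr \<rho>" for i
    using assms(3,5) by (simp add: down_only_type_def)
  interpret urn_walk M X "\<lambda>y. real y powr \<alpha>" "\<lambda>i. real (Suc i) powr \<rho>"
  proof (rule urn_walk_if_down_only[where \<delta> = \<delta>])
    show "f l x = \<delta> l * real (Suc x) powr \<alpha>" for l x
      using assms(2,4) by (simp add: factor_type_def)
    show "mono (\<lambda>i. real (Suc i) powr \<rho>)"
      using assms(7) by (intro monoI powr_mono2) auto
    show "\<delta> (2 * i) = real (Suc i) powr \<rho>" "\<delta> (2 * i + 1) = real (Suc i) powr \<rho>" for i
      using assms(5)[of i] odd[of i] by (simp_all add: add.commute)
  qed auto
  interpret power_urn_walk M X \<alpha> \<rho>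
    by unfold_locales (use assms(6,7) in auto)
  show ?thesis
    using weak_reinforcement_recurrent medium_reinforcement_transient
      strong_reinforcement_localizes assms(6,7) by auto
qed

end
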